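(* Let $X$ be a real Banach space, $V$ a reflexive real Banach space, $Z$ a real Hilbert space, $W$ a reflexive Banach space, and $U$ a nonempty weakly closed subset of $W$. Let $\pi:V\to Z$ be a linear continuous operator such that $v_n\rightharpoonup v$ in $V$ implies $\pi v_n\to\pi v$ in $Z$. For each $q\in U$ let $(F_q,x_{0q},K_q,A_q,j_q,f_q)$ be admissible data with constants $(L_{Jq})_J,L'_q,L''_q,m_q,\alpha_q,\beta_q$ (admissibility is defined in the context), and let $(x_q,u_q)\in C^1(I;X)\times C(I;V)$ be the unique solution of Problem $\mathcal{P}$ for these data. Let $\mathcal{L}:X\times V\times U\to\mathbb{R}$ satisfy: for all sequences $\{x_n\}\subset X$, $\{u_n\}\subset V$, $\{q_n\}\subset U$ with $x_n\to x$ in $X$, $u_n\to u$ in $V$, $q_n\rightharpoonup q$ in $W$, $$\liminf_{n\to\infty}\mathcal{L}(x_n,u_n,q_n)\ge\mathcal{L}(x,u,q).$$ Assume that at least one of the following holds: (i) there exists $z:U\to\mathbb{R}$ such that $\mathcal{L}(x,u,q)\ge z(q)$ for all $x\in X$, $u\in V$, $q\in U$, and $\|q_n\|_W\to\infty$ implies $z(q_n)\to\infty$; (ii) $U$ is a bounded subset of $W$. Assume moreover that for each sequence $\{q_n\}\subset U$ with $q_n\rightharpoonup q$ in $W$, writing $F=F_q$, $x_0=x_{0q}$, $K=K_q$, $A=A_q$, $j=j_q$, $f=f_q$ (with constants $L_J=L_{Jq}$, $L'=L'_q$, $L''=L''_q$, $m=m_q$, $\alpha=\alpha_q$, $\beta=\beta_q$)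 and $F_n=F_{q_n}$, $x_{0n}=x_{0q_n}$, $K_n=K_{q_n}$, $A_n=A_{q_n}$, $j_n=j_{q_n}$, $f_n=f_{q_n}$ (with constants $L_{Jn}=L_{Jq_n}$, $L'_n=L'_{q_n}$, $L''_n=L''_{q_n}$, $m_n=m_{q_n}$, $\alpha_n=\alpha_{q_n}$, $\beta_n=\beta_{q_n}$), the following hold: 1. For all $n$ and all compact $J\subset I$: $L_{Jn}\le L_J$, $L'_n\le L'$, $L''_n\le L''$, $m_n\ge m$, $\alpha_n\le\alpha$, $\beta_n\le\beta$. 2. For all $n$ there exist $\Gamma_n\ge 0$, $\gamma_n\ge 0$ such that $\|F_n(t,x,u)-F(t,x,u)\|_X\le \Gamma_n(\|x\|_X+\|u\|_V+\gamma_n)$ for all $t\in I$, $x\in X$, $u\in V$; moreover $\Gamma_n\to 0$ and $\{\gamma_n\}$ is bounded. 3. $x_{0n}\to x_0$ in $X$. 4. $\{K_n\}$ converges to $K$ in the sense of Mosco, i.e.: (a) for each $v\in K$ there is a sequence $\{v_n\}$ with $v_n\in K_n$ for all $n$ and $v_n\to v$ in $V$; (b) for each $\{v_n\}$ with $v_n\in K_n$ for all $n$ and $v_n\rightharpoonup v$ in $V$, we have $v\in K$. 5. For all $n$ there exist $\Lambda_n\ge0$, $\lambda_n\ge 0$ such that $\|A_n(x,u)-A(x,u)\|_{V^*}\le \Lambda_n(\|x\|_X+\|u\|_V+\lambda_n)$ for all $x\in X$, $u\in V$; moreover $\Lambda_n\to0$ and $\{\lambda_n\}$ is bounded. 6.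 (a) For all $n$ there exist $\tau_n\ge 0$, $\delta_n\ge 0$ such that $j_n(x,u,v_1)-j_n(x,u,v_2)\le[\tau_n+\delta_n(\|x\|_X+\|u\|_V)]\,\|v_1-v_2\|_V$ for all $x\in X$, $u,v_1,v_2\in V$. (b) There exist $\tau_0>0$, $\delta_0>0$ such that $\tau_n\le\tau_0$ and $\delta_n\le\delta_0<m$ for all $n$. (c) For any sequences $\{u_n\},\{v_n\}\subset V$ with $u_n\rightharpoonup u$ and $v_n\rightharpoonup v$ in $V$, one has $\limsup_{n\to\infty}[j_n(x,u_n,v_n)-j_n(x,u_n,u_n)]\le j(x,u,v)-j(x,u,u)$ for all $x\in X$. 7. (a) $f_n(t)\rightharpoonup f(t)$ in $Z$ for all $t\in I$. (b) For any compact $J\subset I$ there exists $w_J>0$ with $\|f_n(t)\|_Z\le w_J$ for all $n\in\mathbb{N}$, $t\in J$. Then, for each $t\in I$, there exists at least one $q^*\in U$ such that $$\mathcal{L}(x_{q^*}(t),u_{q^*}(t),q^* )=\min_{q\in U}\mathcal{L}(x_q(t),u_q(t),q).$$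
   Context: $I$ denotes either $[0,T]$ with $T>0$ or $[0,+\infty)$. $V^*$ is the topological dual of $V$, $\langle\cdot,\cdot\rangle$ the duality pairing, $(\cdot,\cdot)_Z$ the inner product of $Z$; $\to$ and $\rightharpoonup$ denote strong and weak convergence. Problem $\mathcal{P}$ for data $(F,x_0,K,A,j,f)$, where $F:I\times X\times V\to X$, $x_0\in X$, $K\subset V$, $A:X\times V\to V^*$, $j:X\times V\times V\to\mathbb{R}$, $f:I\to Z$: find $x\in C^1(I;X)$ and $u\in C(I;V)$ such that $\dot x(t)=F(t,x(t),u(t))$ for all $t\in I$, $x(0)=x_0$, and for all $t\in I$: $u(t)\in K$ and $$\langle A(x(t),u(t)),v-u(t)\rangle+j(x(t),u(t),v)-j(x(t),u(t),u(t))\ge (f(t),\pi v-\pi u(t))_Z\quad\forall v\in K.$$ The data $(F,x_0,K,A,j,f)$ are called admissible with constants $(L_J)_J$ (one for each compact $J\subset I$), $L',L'',m,\alpha,\beta$, all positive, if: - $t\mapsto F(t,x,u)$ is continuous for all $x\in X$, $u\in V$, and for every compact $J\subset I$, $\|F(t,x_1,u_1)-F(t,x_2,u_2)\|_X\le L_J(\|x_1-x_2\|_X+\|u_1-u_2\|_V)$ for all $x_1,x_2\in X$, $u_1,u_2\in V$, $t\in J$; - $x_0\in X$; $K$ is a nonempty closed convex subset of $V$; - $\|A(x_1,u)-A(x_2,u)\|_{V^*}\le L'\|x_1-x_2\|_X$, $\|A(x,u_1)-A(x,u_2)\|_{V^*}\le L''\|u_1-u_2\|_V$ and $\langle A(x,u_1)-A(x,u_2),u_1-u_2\rangle\ge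 m\|u_1-u_2\|_V^2$ for all $x,x_1,x_2\in X$, $u,u_1,u_2\in V$; - $j(x,u,\cdot)$ is convex and lower semicontinuous on $V$ for all $x\in X$, $u\in V$, and $j(x_1,u_1,v_2)-j(x_1,u_1,v_1)+j(x_2,u_2,v_1)-j(x_2,u_2,v_2)\le\alpha\|x_1-x_2\|_X\|v_1-v_2\|_V+\beta\|u_1-u_2\|_V\|v_1-v_2\|_V$ for all $x_1,x_2\in X$, $u_1,u_2,v_1,v_2\in V$; - $m>\beta$; $f\in C(I;Z)$. For admissible data (with $V$ reflexive and $\pi$ linear continuous) it is known that Problem $\mathcal{P}$ has a unique solution. *)

theory Defs
  imports "HOL-Analysis.Analysis"
begin

text \<open>The topological dual of a real normed space \<open>'a\<close> is \<open>'a \<Rightarrow>\<^sub>L real\<close> with the operator norm,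
  and the duality pairing is \<^const>\<open>blinfun_apply\<close>.\<close>

definition reflexive_space :: "'a::real_normed_vector itself \<Rightarrow> bool" where
  "reflexive_space _ \<longleftrightarrow>
     (\<forall>\<Phi> :: ('a \<Rightarrow>\<^sub>L real) \<Rightarrow>\<^sub>L real. \<exists>v::'a. \<forall>\<phi>. blinfun_apply \<Phi> \<phi> = blinfun_apply \<phi> v)"

definition weak_topology :: "'a::real_normed_vector topology" where
  "weak_topology =
     topology_generated_by {blinfun_apply \<phi> -` S | (\<phi> :: 'a \<Rightarrow>\<^sub>L real) (S :: real set). open S}"

definition weak_LIMSEQ :: "(nat \<Rightarrow> 'a::real_normed_vector) \<Rightarrow> 'a \<Rightarrow> bool"
    (\<open>((_)/ \<rightharpoonup> (_))\<close> [60, 60] 60) where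
  "xs \<rightharpoonup> x \<longleftrightarrow>
     (\<forall>\<phi> :: 'a \<Rightarrow>\<^sub>L real. (\<lambda>n. blinfun_apply \<phi> (xs n)) \<longlonglongrightarrow> blinfun_apply \<phi> x)"

definition lower_semicont :: "('a::topological_space \<Rightarrow> real) \<Rightarrow> bool" where
  "lower_semicont g \<longleftrightarrow> (\<forall>v. \<forall>a < g v. eventually (\<lambda>w. a < g w) (nhds v))"

definition mosco_converges :: "(nat \<Rightarrow> 'a::real_normed_vector set) \<Rightarrow> 'a set \<Rightarrow> bool" where
  "mosco_converges Ks K \<longleftrightarrow>
     (\<forall>v\<in>K. \<exists>vs. (\<forall>n. vs n \<in> Ks n) \<and> vs \<longlonglongrightarrow> v) \<and>
     (\<forall>vs v. (\<forall>n. vs n \<in> Ks n) \<and> vs \<rightharpoonup> v \<longrightarrow> v \<in> K)"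

text \<open>The derivative is taken within \<open>I\<close>, i.e. one-sidedly at the endpoints of \<open>I\<close>.\<close>

definition C1_on :: "real set \<Rightarrow> (real \<Rightarrow> 'a::real_normed_vector) \<Rightarrow> bool" where
  "C1_on I x \<longleftrightarrow>
     (\<exists>x'. (\<forall>t\<in>I. (x has_vector_derivative x' t) (at t within I)) \<and> continuous_on I x')"

definition solves_P ::
  "real set \<Rightarrow> ('v::real_normed_vector \<Rightarrow> 'z::real_inner)
    \<Rightarrow> (real \<Rightarrow> 'x::real_normed_vector \<Rightarrow> 'v \<Rightarrow> 'x) \<Rightarrow> 'x \<Rightarrow> 'v set
    \<Rightarrow> ('x \<Rightarrow> 'v \<Rightarrow> 'v \<Rightarrow>\<^sub>L real) \<Rightarrow> ('x \<Rightarrow> 'v \<Rightarrow> 'v \<Rightarrow> real) \<Rightarrow> (real \<Rightarrow> 'z)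
    \<Rightarrow> (real \<Rightarrow> 'x) \<Rightarrow> (real \<Rightarrow> 'v) \<Rightarrow> bool" where
  "solves_P I \<pi> F x0 K A j f x u \<longleftrightarrow>
     C1_on I x \<and> continuous_on I u \<and>
     (\<forall>t\<in>I. (x has_vector_derivative F t (x t) (u t)) (at t within I)) \<and>
     x 0 = x0 \<and>
     (\<forall>t\<in>I. u t \<in> K \<and>
        (\<forall>v\<in>K. blinfun_apply (A (x t) (u t)) (v - u t) + j (x t) (u t) v - j (x t) (u t) (u t)
                 \<ge> inner (f t) (\<pi> v - \<pi> (u t))))"

definition admissible ::
  "real set \<Rightarrow> (real \<Rightarrow> 'x::real_normed_vector \<Rightarrow> 'v::real_normed_vector \<Rightarrow> 'x) \<Rightarrow> 'v set
    \<Rightarrow> ('x \<Rightarrow> 'v \<Rightarrow> 'v \<Rightarrow>\<^sub>L real) \<Rightarrow> ('x \<Rightarrow> 'v \<Rightarrow> 'v \<Rightarrow> real) \<Rightarrow> (real \<Rightarrow> 'z::real_inner)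
    \<Rightarrow> (real set \<Rightarrow> real) \<Rightarrow> real \<Rightarrow> real \<Rightarrow> real \<Rightarrow> real \<Rightarrow> real \<Rightarrow> bool" where
  "admissible I F K A j f LJ L' L'' m \<alpha> \<beta> \<longleftrightarrow>
     (\<forall>J. compact J \<and> J \<subseteq> I \<longrightarrow> LJ J > 0) \<and>
     L' > 0 \<and> L'' > 0 \<and> m > 0 \<and> \<alpha> > 0 \<and> \<beta> > 0 \<and>
     (\<forall>x u. continuous_on I (\<lambda>t. F t x u)) \<and>
     (\<forall>J. compact J \<and> J \<subseteq> I \<longrightarrow>
        (\<forall>x1 x2 u1 u2. \<forall>t\<in>J.
           norm (F t x1 u1 - F t x2 u2) \<le> LJ J * (norm (x1 - x2) + norm (u1 - u2)))) \<and>
     K \<noteq> {} \<and> closed K \<and> convex K \<and>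
     (\<forall>x1 x2 u. norm (A x1 u - A x2 u) \<le> L' * norm (x1 - x2)) \<and>
     (\<forall>x u1 u2. norm (A x u1 - A x u2) \<le> L'' * norm (u1 - u2)) \<and>
     (\<forall>x u1 u2. blinfun_apply (A x u1 - A x u2) (u1 - u2) \<ge> m * (norm (u1 - u2))\<^sup>2) \<and>
     (\<forall>x u. convex_on UNIV (j x u) \<and> lower_semicont (j x u)) \<and>
     (\<forall>x1 x2 u1 u2 v1 v2.
        j x1 u1 v2 - j x1 u1 v1 + j x2 u2 v1 - j x2 u2 v2
          \<le> \<alpha> * norm (x1 - x2) * norm (v1 - v2) + \<beta> * norm (u1 - u2) * norm (v1 - v2)) \<and>
     m > \<beta> \<and> continuous_on I f"

end

theory Submission
  imports Defs "HOL-Library.Diagonal_Subsequence"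
begin

text \<open>
  The direct method of the calculus of variations: a minimizing sequence of controls is bounded
  by coercivity, or because \<open>U\<close> is bounded, and hence has a subsequence \<open>qs\<close> converging weakly to some
  \<open>q \<in> U\<close>, because \<open>W\<close> is reflexive and \<open>U\<close> is weakly closed. If \<open>x (qs n) t\<close> and \<open>u (qs n) t\<close> converge in
  norm to \<open>x q t\<close> and \<open>u q t\<close>, the lower semicontinuity of \<open>\<L>\<close> shows that \<open>q\<close> is optimal
  (\<open>weakly_coercive_attains_min\<close>). So the content is the continuous dependence of the solution on
  the control, \<open>solutions_LIMSEQ\<close>.

  At a fixed time, write \<open>d\<close> for the gap of \<open>x\<close> and \<open>s\<close> for the gap of \<open>u\<close> between the controls \<open>qs n\<close>
  and \<open>q\<close>. Comparing the two variational inequalities gives \<open>s \<le> c * d\<close> up to an error \<open>excess\<close>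
  that tends to zero at each time, with \<open>c = (L' + \<alpha>) / (m - \<beta>)\<close> (\<open>vi_gap\<close>). The bound
  holds asymptotically for whatever limit \<open>d\<close> has along a subsequence, so it can be fed into the
  state equation, where \<open>d\<close> is still unknown. The gaps are bounded uniformly in time (\<open>gaps_bounded\<close>), so the time integral of the excess tends to
  zero by dominated convergence, and Gronwall's inequality for the difference of the state equations
  yields \<open>d \<longrightarrow> 0\<close> and then \<open>s \<longrightarrow> 0\<close>.

  Weak sequential compactness of bounded sets in reflexive spaces
  (\<open>reflexive_bounded_weak_subsequence\<close>) is derived from the Hahn--Banach theorem for sublinear
  functions on a real vector space, applied once more on the dual space to the upper limit along the
  sequence.
\<close>

section \<open>The Hahn--Banach theorem\<close>

text \<open>Positive homogeneity is only asked as an inequality, which is easier to check for infima;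
  equality follows by rescaling with \<open>inverse c\<close>.\<close>

definition sublinear :: "('a::real_vector \<Rightarrow> real) \<Rightarrow> bool" where
  "sublinear p \<longleftrightarrow>
     (\<forall>x y. p (x + y) \<le> p x + p y) \<and> (\<forall>c\<ge>0. \<forall>x. p (c *\<^sub>R x) \<le> c * p x)"

lemma sublinearI:
  assumes "\<And>x y. p (x + y) \<le> p x + p y" "\<And>c x. c \<ge> 0 \<Longrightarrow> p (c *\<^sub>R x) \<le> c * p x"
  shows "sublinear p"
  using assms unfolding sublinear_def by blast

lemma sublinear_add: "sublinear p \<Longrightarrow> p (x + y) \<le> p x + p y"
  unfolding sublinear_def by blast

lemma sublinear_zero: "sublinear p \<Longrightarrow> p 0 = 0"
  unfolding sublinear_def
  by (metis add.right_neutral add_le_cancel_left dual_order.antisym mult_zero_left order_refl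
      scale_zero_left)

lemma sublinear_scaleR:
  assumes p: "sublinear p" and "c \<ge> 0"
  shows "p (c *\<^sub>R x) = c * p x"
proof (cases "c = 0")
  case True
  then show ?thesis by (simp add: sublinear_zero[OF p])
next
  case False
  with \<open>c \<ge> 0\<close> have "c > 0" by simp
  have "p (inverse c *\<^sub>R c *\<^sub>R x) \<le> inverse c * p (c *\<^sub>R x)"
    using p \<open>c > 0\<close> unfolding sublinear_def by (meson inverse_nonnegative_iff_nonnegative less_imp_le)
  hence "c * p x \<le> p (c *\<^sub>R x)"
    using \<open>c > 0\<close> by (simp add: field_simps)
  moreover have "p (c *\<^sub>R x) \<le> c * p x"
    using p \<open>c \<ge> 0\<close> unfolding sublinear_def by blast
  ultimately show ?thesis by simp
qed

lemma sublinear_lower: "sublinear p \<Longrightarrow> - p (- x) \<le> p x"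
  using sublinear_add[of p x "- x"] sublinear_zero[of p] by simp

text \<open>A sublinear minorant of \<open>p\<close> whose value at \<open>- z\<close> is at most \<open>- p z\<close>. Hence a minimal sublinear
  function \<open>f\<close>, which must equal \<open>tilt f z\<close> for every \<open>z\<close>, is odd; and any sublinear minorant of
  \<open>tilt p z\<close> that is odd takes a value of at least \<open>p z\<close> at \<open>z\<close>.\<close>

definition tilt :: "('a::real_vector \<Rightarrow> real) \<Rightarrow> 'a \<Rightarrow> 'a \<Rightarrow> real" where
  "tilt p z x = (INF t\<in>{0..}. p (x + t *\<^sub>R z) - t * p z)"

lemma tilt_lower:
  assumes p: "sublinear p" and "t \<ge> 0"
  shows "- p (- x) \<le> p (x + t *\<^sub>R z) - t * p z"
  using sublinear_add[OF p, of "x + t *\<^sub>R z" "- x"] sublinear_scaleR[OF p \<open>t \<ge> 0\<close>, of z] by simp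

lemma tilt_le:
  assumes p: "sublinear p" and "t \<ge> 0"
  shows "tilt p z x \<le> p (x + t *\<^sub>R z) - t * p z"
  unfolding tilt_def
proof (rule cINF_lower)
  show "bdd_below ((\<lambda>t. p (x + t *\<^sub>R z) - t * p z) ` {0..})"
    by (intro bdd_belowI2[of _ "- p (- x)"]) (use tilt_lower[OF p] in auto)
qed (use \<open>t \<ge> 0\<close> in auto)

lemma tilt_greatest: "(\<And>t. t \<ge> 0 \<Longrightarrow> b \<le> p (x + t *\<^sub>R z) - t * p z) \<Longrightarrow> b \<le> tilt p z x"
  unfolding tilt_def by (intro cINF_greatest) auto

lemma sublinear_tilt:
  assumes p: "sublinear p"
  shows "sublinear (tilt p z)"
proof (rule sublinearI)
  fix x y
  have "tilt p z (x + y) - (p (x + s *\<^sub>R z) - s * p z) \<le> p (y + t *\<^sub>R z) - t * p z"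
    if "s \<ge> 0" "t \<ge> 0" for s t
    using tilt_le[OF p, of "s + t" z "x + y"] that
      sublinear_add[OF p, of "x + s *\<^sub>R z" "y + t *\<^sub>R z"]
    by (simp add: algebra_simps)
  hence "tilt p z (x + y) - (p (x + s *\<^sub>R z) - s * p z) \<le> tilt p z y" if "s \<ge> 0" for s
    by (rule tilt_greatest) (use that in auto)
  hence "tilt p z (x + y) - tilt p z y \<le> p (x + s *\<^sub>R z) - s * p z" if "s \<ge> 0" for s
    using that by (simp add: algebra_simps)
  hence "tilt p z (x + y) - tilt p z y \<le> tilt p z x"
    by (rule tilt_greatest)
  thus "tilt p z (x + y) \<le> tilt p z x + tilt p z y" by simp
next
  fix c :: real and x
  assume "c \<ge> 0"
  show "tilt p z (c *\<^sub>R x) \<le> c * tilt p z x"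
  proof (cases "c = 0")
    case True
    then show ?thesis using tilt_le[OF p, of 0 z 0] sublinear_zero[OF p] by simp
  next
    case False
    with \<open>c \<ge> 0\<close> have "c > 0" by simp
    have "tilt p z (c *\<^sub>R x) / c \<le> p (x + t *\<^sub>R z) - t * p z" if "t \<ge> 0" for t
      using tilt_le[OF p, of "c * t" z "c *\<^sub>R x"] that \<open>c > 0\<close>
        sublinear_scaleR[OF p \<open>c \<ge> 0\<close>, of "x + t *\<^sub>R z"]
      by (simp add: field_simps scaleR_right_distrib)
    hence "tilt p z (c *\<^sub>R x) / c \<le> tilt p z x"
      by (rule tilt_greatest)
    thus ?thesis using \<open>c > 0\<close> by (simp add: field_simps)
  qed
qed

text \<open>Zorn's lemma for the reversed pointwise order: the infimum of a chain is finite because every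
  sublinear \<open>q \<le> p\<close> satisfies \<open>q x \<ge> - p (- x)\<close>, and it is subadditive because two members of a chain
  have a common minorant in the chain.\<close>

lemma minimal_sublinear_exists:
  assumes p: "sublinear p"
  shows "\<exists>q. sublinear q \<and> q \<le> p \<and> (\<forall>r. sublinear r \<longrightarrow> r \<le> q \<longrightarrow> r = q)"
proof -
  define S where "S = {q. sublinear q \<and> q \<le> p}"
  define P where "P = (\<lambda>q r :: 'a \<Rightarrow> real. r \<le> q)"
  have "\<exists>m\<in>S. \<forall>a\<in>S. P m a \<longrightarrow> a = m"
  proof (rule predicate_Zorn)
    show "partial_order_on S (relation_of P S)"
      by (rule partial_order_on_relation_ofI) (auto simp: P_def)
  next
    fix C assume C: "C \<in> Chains (relation_of P S)"
    hence CS: "C \<subseteq> S" and tot: "\<And>q r. q \<in> C \<Longrightarrow> r \<in> C \<Longrightarrow> P q r \<or> P r q"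
      by (auto simp: Chains_def relation_of_def)
    show "\<exists>u\<in>S. \<forall>a\<in>C. P a u"
    proof (cases "C = {}")
      case True
      then show ?thesis using p by (auto simp: S_def)
    next
      case False
      define g where "g = (\<lambda>x. INF q\<in>C. q x)"
      have lower: "- p (- x) \<le> q x" if "q \<in> C" for q x
      proof -
        have "sublinear q" "q (- x) \<le> p (- x)" using that CS by (auto simp: S_def le_fun_def)
        thus ?thesis using sublinear_lower[of q x] by simp
      qed
      have g_le: "g x \<le> q x" if "q \<in> C" for q x
        unfolding g_def using that lower by (intro cINF_lower bdd_belowI2[of _ "- p (- x)"]) auto
      have g_gr: "b \<le> g x" if "\<And>q. q \<in> C \<Longrightarrow> b \<le> q x" for b x
        unfolding g_def using that False by (intro cINF_greatest) auto
      have "sublinear g"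
      proof (rule sublinearI)
        fix x y
        have "g (x + y) - q x \<le> r y" if qr: "q \<in> C" "r \<in> C" for q r
        proof -
          obtain s where "s \<in> C" "s x \<le> q x" "s y \<le> r y"
            using tot[OF qr] qr by (auto simp: P_def le_fun_def)
          moreover have "g (x + y) \<le> s x + s y"
            using g_le[OF \<open>s \<in> C\<close>, of "x + y"] sublinear_add[of s x y] CS \<open>s \<in> C\<close>
            by (auto simp: S_def)
          ultimately show ?thesis by simp
        qed
        hence le: "g (x + y) - q x \<le> g y" if "q \<in> C" for q
          by (rule g_gr) (use that in auto)
        have "g (x + y) - g y \<le> q x" if "q \<in> C" for q
          using le[OF that] by simp
        hence "g (x + y) - g y \<le> g x" by (rule g_gr)
        thus "g (x + y) \<le> g x + g y" by simp
      next
        fix c :: real and x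
        assume "c \<ge> 0"
        show "g (c *\<^sub>R x) \<le> c * g x"
        proof (cases "c = 0")
          case True
          obtain q where "q \<in> C" using False by blast
          hence "g 0 \<le> 0" using g_le[of q 0] CS sublinear_zero[of q] by (auto simp: S_def)
          then show ?thesis using True by simp
        next
          case False
          with \<open>c \<ge> 0\<close> have "c > 0" by simp
          have "g (c *\<^sub>R x) / c \<le> q x" if "q \<in> C" for q
            using g_le[OF that, of "c *\<^sub>R x"] sublinear_scaleR[of q c x] CS that \<open>c > 0\<close>
            by (auto simp: S_def field_simps)
          hence "g (c *\<^sub>R x) / c \<le> g x" by (rule g_gr)
          thus ?thesis using \<open>c > 0\<close> by (simp add: field_simps)
        qed
      qed
      moreover have "g \<le> p"
      proof -
        obtain q where "q \<in> C" using False by blast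
        hence "g \<le> q" "q \<le> p" using g_le CS by (auto simp: S_def le_fun_def)
        thus ?thesis by (rule order_trans)
      qed
      ultimately have "g \<in> S" by (simp add: S_def)
      thus ?thesis using g_le by (auto simp: P_def le_fun_def)
    qed
  qed
  then obtain q where q: "q \<in> S" "\<forall>r\<in>S. P q r \<longrightarrow> r = q" by blast
  have "r = q" if r: "sublinear r" "r \<le> q" for r
  proof -
    have "r \<le> p" using r(2) q(1) order_trans by (auto simp: S_def)
    thus ?thesis using q(2) r by (auto simp: S_def P_def)
  qed
  thus ?thesis using q(1) by (auto simp: S_def)
qed

text \<open>A minimal sublinear function is odd, and an odd sublinear function is linear. Starting Zorn's
  lemma below \<open>tilt p z\<close> instead of \<open>p\<close> gives contact with \<open>p\<close> at \<open>z\<close>. The choices \<open>p = norm\<close>, the distance to a subspace, and an upper limit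
  on the dual space are the three used below.\<close>

theorem hahn_banach_sublinear:
  assumes p: "sublinear p"
  obtains f where "linear f" "\<And>x. f x \<le> p x" "f z = p z"
proof -
  obtain f where f: "sublinear f" "f \<le> tilt p z"
    and min: "\<And>r. sublinear r \<Longrightarrow> r \<le> f \<Longrightarrow> r = f"
    using minimal_sublinear_exists[OF sublinear_tilt[OF p, of z]] by blast
  have le: "f x \<le> p x" for x
    using le_funD[OF f(2), of x] tilt_le[OF p, of 0 z x] by simp
  have odd: "f (- y) = - f y" for y
  proof -
    have "tilt f y = f"
      using tilt_le[OF f(1), of 0 y] by (intro min sublinear_tilt f le_funI) simp
    hence "f (- y) \<le> - f y"
      using tilt_le[OF f(1), of 1 y "- y"] sublinear_zero[OF f(1)] by simp
    thus ?thesis using sublinear_lower[OF f(1), of y] by simp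
  qed
  have "linear f"
  proof (rule linearI)
    fix x y :: 'a
    show "f (x + y) = f x + f y"
      using sublinear_add[OF f(1), of x y] sublinear_add[OF f(1), of "- x" "- y"] odd[of "x + y"]
      by (simp add: odd)
  next
    fix c :: real and x :: 'a
    show "f (c *\<^sub>R x) = c *\<^sub>R f x"
      using sublinear_scaleR[OF f(1), of c x] sublinear_scaleR[OF f(1), of "- c" x]
        odd[of "c *\<^sub>R x"] by (cases "c \<ge> 0") auto
  qed
  moreover have "f z = p z"
    using le_funD[OF f(2), of "- z"] tilt_le[OF p, of 1 z "- z"] sublinear_zero[OF p] odd[of z] le[of z] by simp
  ultimately show ?thesis using le that by blast
qed

lemma sublinear_norm: "sublinear (norm :: 'a::real_normed_vector \<Rightarrow> real)"
  by (rule sublinearI) (auto intro: norm_triangle_ineq)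

lemma dominated_linear_blinfun:
  fixes f :: "'a::real_normed_vector \<Rightarrow> real"
  assumes "linear f" and le: "\<And>x. f x \<le> C * norm x"
  obtains \<phi> :: "'a \<Rightarrow>\<^sub>L real" where "blinfun_apply \<phi> = f"
proof -
  have "norm (f x) \<le> norm x * C" for x
    using le[of x] le[of "- x"] linear_neg[OF \<open>linear f\<close>, of x] by (simp add: abs_le_iff mult.commute)
  hence "bounded_linear f"
    using \<open>linear f\<close> by (intro bounded_linear_intro[where K = C])
      (auto simp: linear_add linear_scale)
  thus ?thesis using that bounded_linear_Blinfun_apply by blast
qed

lemma norming_functional:
  fixes z :: "'a::real_normed_vector"
  obtains \<phi> :: "'a \<Rightarrow>\<^sub>L real" where "blinfun_apply \<phi> z = norm z" "\<And>x. \<bar>blinfun_apply \<phi> x\<bar> \<le> norm x"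
proof -
  obtain f where f: "linear f" "\<And>x. f x \<le> norm x" "f z = norm z"
    using hahn_banach_sublinear[OF sublinear_norm] by blast
  obtain \<phi> :: "'a \<Rightarrow>\<^sub>L real" where "blinfun_apply \<phi> = f"
    using dominated_linear_blinfun[of f 1] f by auto
  moreover have "\<bar>f x\<bar> \<le> norm x" for x
    using f(2)[of x] f(2)[of "- x"] linear_neg[OF f(1), of x] by (simp add: abs_le_iff)
  ultimately show ?thesis using f that by blast
qed

text \<open>The distance to a subspace is sublinear, vanishes on the subspace and is positive off its
  closure; a linear minorant touching it at \<open>z\<close> therefore separates.\<close>

lemma separating_functional_subspace:
  fixes S :: "'a::real_normed_vector set"
  assumes S: "subspace S" and z: "z \<notin> closure S"
  obtains \<phi> :: "'a \<Rightarrow>\<^sub>L real" where "\<And>y. y \<in> S \<Longrightarrow> blinfun_apply \<phi> y = 0" "blinfun_apply \<phi> z > 0"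
proof -
  have ne: "S \<noteq> {}" using subspace_0[OF S] by blast
  have sub: "sublinear (\<lambda>x. infdist x S)"
  proof (rule sublinearI)
    fix x y
    have "infdist (x + y) S - dist x a \<le> dist y b" if "a \<in> S" "b \<in> S" for a b
      using infdist_le[OF subspace_add[OF S that], of "x + y"] norm_triangle_ineq[of "x - a" "y - b"]
      by (simp add: dist_norm algebra_simps)
    hence "infdist (x + y) S - dist x a \<le> infdist y S" if "a \<in> S" for a
      using ne that by (auto simp: infdist_notempty intro: cINF_greatest)
    hence "infdist (x + y) S - infdist y S \<le> dist x a" if "a \<in> S" for a
      using that by (simp add: algebra_simps)
    hence "infdist (x + y) S - infdist y S \<le> infdist x S"
      using ne by (auto simp: infdist_notempty intro: cINF_greatest)
    thus "infdist (x + y) S \<le> infdist x S + infdist y S" by simp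
  next
    fix c :: real and x
    assume "c \<ge> 0"
    show "infdist (c *\<^sub>R x) S \<le> c * infdist x S"
    proof (cases "c = 0")
      case True
      then show ?thesis using infdist_zero[OF subspace_0[OF S]] by simp
    next
      case False
      with \<open>c \<ge> 0\<close> have "c > 0" by simp
      have "infdist (c *\<^sub>R x) S / c \<le> dist x a" if "a \<in> S" for a
      proof -
        have "infdist (c *\<^sub>R x) S \<le> norm (c *\<^sub>R (x - a))"
          using infdist_le[OF subspace_scale[OF S that, of c], of "c *\<^sub>R x"]
          by (simp add: dist_norm scaleR_diff_right)
        hence "infdist (c *\<^sub>R x) S \<le> c * dist x a"
          using \<open>c > 0\<close> by (simp only: norm_scaleR dist_norm abs_of_pos)
        thus ?thesis using \<open>c > 0\<close> by (simp add: field_simps)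
      qed
      hence "infdist (c *\<^sub>R x) S / c \<le> infdist x S"
        using ne by (auto simp: infdist_notempty intro: cINF_greatest)
      thus ?thesis using \<open>c > 0\<close> by (simp add: field_simps)
    qed
  qed
  obtain f where f: "linear f" "\<And>x. f x \<le> infdist x S" "f z = infdist z S"
    using hahn_banach_sublinear[OF sub] by blast
  have "infdist x S \<le> norm x" for x
    using infdist_le[OF subspace_0[OF S], of x] by simp
  then obtain \<phi> :: "'a \<Rightarrow>\<^sub>L real" where \<phi>: "blinfun_apply \<phi> = f"
    using dominated_linear_blinfun[of f 1] f(1,2) order_trans by (metis (mono_tags) mult_1)
  show ?thesis
  proof (rule that)
    fix y assume "y \<in> S"
    hence "f y \<le> 0" "f (- y) \<le> 0"
      using f(2)[of y] f(2)[of "- y"] subspace_neg[OF S] by (auto simp: infdist_zero)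
    thus "blinfun_apply \<phi> y = 0" using linear_neg[OF f(1), of y] \<phi> by simp
  next
    show "blinfun_apply \<phi> z > 0"
      using \<phi> f(3) z ne in_closure_iff_infdist_zero[OF ne, of z] infdist_nonneg[of z S] by simp
  qed
qed

section \<open>Weak convergence\<close>

lemma LIMSEQ_if_subsequences:
  fixes f :: "nat \<Rightarrow> 'a::topological_space"
  assumes sub: "\<And>s :: nat \<Rightarrow> nat. strict_mono s \<Longrightarrow> \<exists>r :: nat \<Rightarrow> nat. strict_mono r \<and> (f \<circ> s \<circ> r) \<longlonglongrightarrow> l"
  shows "f \<longlonglongrightarrow> l"
proof (rule topological_tendstoI, rule ccontr)
  fix S assume S: "open S" "l \<in> S" and "\<not> eventually (\<lambda>n. f n \<in> S) sequentially"
  hence inf: "infinite {n. f n \<notin> S}"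
    by (simp add: eventually_cofinite cofinite_eq_sequentially[symmetric])
  define s where "s = enumerate {n. f n \<notin> S}"
  have s: "strict_mono s" "\<And>n. f (s n) \<notin> S"
    using strict_mono_enumerate[OF inf] enumerate_in_set[OF inf] by (auto simp: s_def)
  obtain r :: "nat \<Rightarrow> nat" where r: "strict_mono r" "(f \<circ> s \<circ> r) \<longlonglongrightarrow> l"
    using sub[OF s(1)] by blast
  have "eventually (\<lambda>n. (f \<circ> s \<circ> r) n \<in> S) sequentially"
    by (rule topological_tendstoD[OF r(2) S])
  thus False using s(2) by (auto simp: eventually_sequentially)
qed

lemma weak_LIMSEQ_blinfun:
  fixes \<phi> :: "'a::real_normed_vector \<Rightarrow>\<^sub>L real"
  shows "xs \<rightharpoonup> x \<Longrightarrow> (\<lambda>n. blinfun_apply \<phi> (xs n)) \<longlonglongrightarrow> blinfun_apply \<phi> x"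
  by (simp add: weak_LIMSEQ_def)

lemma weak_LIMSEQ_subseq: "xs \<rightharpoonup> x \<Longrightarrow> strict_mono r \<Longrightarrow> (\<lambda>n. xs (r n)) \<rightharpoonup> x"
  unfolding weak_LIMSEQ_def using LIMSEQ_subseq_LIMSEQ unfolding o_def by fast

lemma LIMSEQ_imp_weak: "xs \<longlonglongrightarrow> x \<Longrightarrow> xs \<rightharpoonup> x"
  unfolding weak_LIMSEQ_def by (auto intro: bounded_linear.tendsto[OF blinfun.bounded_linear_right])

text \<open>Weak lower semicontinuity of the norm, tested with a functional that norms the limit.\<close>

lemma weak_LIMSEQ_norm_le:
  fixes xs :: "nat \<Rightarrow> 'a::real_normed_vector"
  assumes "xs \<rightharpoonup> x" and lim: "(\<lambda>n. norm (xs n - z)) \<longlonglongrightarrow> s"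
  shows "norm (x - z) \<le> s"
proof -
  obtain \<phi> :: "'a \<Rightarrow>\<^sub>L real" where \<phi>: "blinfun_apply \<phi> (x - z) = norm (x - z)"
    "\<And>w. \<bar>blinfun_apply \<phi> w\<bar> \<le> norm w"
    using norming_functional by blast
  have "(\<lambda>n. blinfun_apply \<phi> (xs n - z)) \<longlonglongrightarrow> norm (x - z)"
    unfolding \<phi>(1)[symmetric] blinfun.diff_right
    by (intro tendsto_diff weak_LIMSEQ_blinfun assms tendsto_const)
  thus ?thesis
    by (rule LIMSEQ_le[OF _ lim]) (use \<phi>(2) abs_le_D1 in blast)
qed

text \<open>Weak convergence of a sequence is convergence in the weak topology: the sets that
  eventually contain the sequence, if they contain the limit, include the generating sets and are
  stable under finite intersections and unions.\<close>

lemma weakly_closed_weak_limit: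
  assumes U: "closedin weak_topology U" and qs: "\<And>n. qs n \<in> U" "qs \<rightharpoonup> q"
  shows "q \<in> U"
proof (rule ccontr)
  assume "q \<notin> U"
  have subbasis: "eventually (\<lambda>n. qs n \<in> S) sequentially"
    if "S \<in> {blinfun_apply \<phi> -` S | (\<phi> :: 'a \<Rightarrow>\<^sub>L real) (S :: real set). open S}" "q \<in> S" for S
    using that topological_tendstoD[OF weak_LIMSEQ_blinfun[OF qs(2)]] by fastforce
  have ev: "eventually (\<lambda>n. qs n \<in> G) sequentially"
    if "generate_topology_on {blinfun_apply \<phi> -` S | (\<phi> :: 'a \<Rightarrow>\<^sub>L real) (S :: real set). open S} G"
      "q \<in> G" for G
    using that
  proof (induction rule: generate_topology_on.induct)
    case (Int a b)
    then show ?case by (auto intro: eventually_conj)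
  next
    case (UN A)
    then obtain k where "k \<in> A" "eventually (\<lambda>n. qs n \<in> k) sequentially" by blast
    then show ?case by (auto elim: eventually_mono)
  qed (use subbasis in auto)
  have "openin weak_topology (topspace weak_topology - U)"
    using U by blast
  hence "generate_topology_on {blinfun_apply \<phi> -` S | (\<phi> :: 'a \<Rightarrow>\<^sub>L real) (S :: real set). open S}
      (topspace weak_topology - U)"
    unfolding weak_topology_def openin_topology_generated_by_iff .
  moreover have "q \<in> topspace (weak_topology :: 'a topology)"
    unfolding weak_topology_def topology_generated_by_topspace by (auto intro!: exI[of _ UNIV])
  ultimately have "eventually (\<lambda>n. qs n \<in> topspace weak_topology - U) sequentially"
    using ev \<open>q \<notin> U\<close> by blast
  thus False using qs(1) by (auto simp: eventually_sequentially)
qed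

lemma inner_weak_strong_LIMSEQ:
  fixes fs :: "nat \<Rightarrow> 'a::real_inner"
  assumes fs: "fs \<rightharpoonup> f" and bd: "\<And>n. norm (fs n) \<le> w" and zs: "zs \<longlonglongrightarrow> z"
  shows "(\<lambda>n. inner (fs n) (zs n)) \<longlonglongrightarrow> inner f z"
proof -
  have "(\<lambda>n. inner (fs n) z) \<longlonglongrightarrow> inner f z"
    using weak_LIMSEQ_blinfun[OF fs, of "blinfun_inner_left z"] by (simp add: inner_commute)
  moreover have "(\<lambda>n. inner (fs n) (zs n - z)) \<longlonglongrightarrow> 0"
  proof (rule Lim_null_comparison)
    have "norm (inner (fs n) (zs n - z)) \<le> w * norm (zs n - z)" for n
      using Cauchy_Schwarz_ineq2[of "fs n" "zs n - z"] mult_right_mono[OF bd[of n], of "norm (zs n - z)"]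
      by simp
    thus "\<forall>\<^sub>F n in sequentially. norm (inner (fs n) (zs n - z)) \<le> w * norm (zs n - z)" by simp
    show "(\<lambda>n. w * norm (zs n - z)) \<longlonglongrightarrow> 0"
      using zs by (auto intro!: tendsto_eq_intros)
  qed
  ultimately have "(\<lambda>n. inner (fs n) z + inner (fs n) (zs n - z)) \<longlonglongrightarrow> inner f z + 0"
    by (rule tendsto_add)
  thus ?thesis by (simp add: inner_diff_right)
qed

section \<open>Weak sequential compactness in reflexive spaces\<close>

text \<open>The dense sequence enumerates the rational linear combinations, encoded as lists of pairs of an
  index and a coefficient: addition is then concatenation of lists, and countability is automatic.\<close>

lemma countable_dense_subspace:
  fixes xs :: "nat \<Rightarrow> 'a::real_normed_vector"
  obtains d :: "nat \<Rightarrow> 'a" where "subspace (closure (range d))" "range xs \<subseteq> range d"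
proof -
  define comb where "comb = (\<lambda>ps :: (nat \<times> rat) list. \<Sum>(i, r)\<leftarrow>ps. real_of_rat r *\<^sub>R xs i)"
  have add: "comb ps + comb qs = comb (ps @ qs)" for ps qs
    by (simp add: comb_def)
  have scale: "real_of_rat c *\<^sub>R comb ps = comb (map (\<lambda>(i, r). (i, c * r)) ps)" for c ps
    by (induction ps) (auto simp: comb_def scaleR_right_distrib of_rat_mult)
  define d where "d = comb \<circ> (from_nat :: nat \<Rightarrow> (nat \<times> rat) list)"
  have range_d: "range d = range comb"
    unfolding d_def image_comp[symmetric] by simp
  have "subspace (closure (range comb))"
  proof (rule subspaceI)
    have "comb [] = 0" by (simp add: comb_def)
    thus "0 \<in> closure (range comb)" by (metis closure_subset rangeI subsetD)
  next
    fix x y assume "x \<in> closure (range comb)" "y \<in> closure (range comb)"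
    then obtain X Y where "\<And>n. X n \<in> range comb" "X \<longlonglongrightarrow> x" "\<And>n. Y n \<in> range comb" "Y \<longlonglongrightarrow> y"
      unfolding closure_sequential by blast
    hence "(\<lambda>n. X n + Y n) \<longlonglongrightarrow> x + y" "X n + Y n \<in> range comb" for n
      by (auto intro: tendsto_add) (metis add image_iff rangeI)
    thus "x + y \<in> closure (range comb)" unfolding closure_sequential by fast
  next
    fix c :: real and x assume "x \<in> closure (range comb)"
    then obtain X where X: "\<And>n. X n \<in> range comb" "X \<longlonglongrightarrow> x"
      unfolding closure_sequential by blast
    have "c \<in> closure \<rat>" by (simp add: Rats_closure_real)
    then obtain R where R: "\<And>n. R n \<in> \<rat>" "R \<longlonglongrightarrow> c"
      unfolding closure_sequential by blast
    have "(\<lambda>n. R n *\<^sub>R X n) \<longlonglongrightarrow> c *\<^sub>R x" using R X by (intro tendsto_scaleR)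
    moreover have "R n *\<^sub>R X n \<in> range comb" for n
      using R(1)[of n] X(1)[of n] scale by (auto simp: Rats_def)
    ultimately show "c *\<^sub>R x \<in> closure (range comb)" unfolding closure_sequential by fast
  qed
  moreover have "xs n \<in> range comb" for n
  proof
    show "xs n = comb [(n, 1)]" by (simp add: comb_def)
  qed simp
  ultimately show ?thesis using that range_d by (metis image_subsetI)
qed

text \<open>Geometrically, by the Hahn--Banach theorem, \<open>y\<close> lies in the closed convex hull of every tail of
  \<open>xs\<close>. This is weaker than being a weak cluster point, but
  it determines \<open>\<phi> y\<close> whenever \<open>\<phi> (xs n)\<close> converges, and it places \<open>y\<close> in every closed
  subspace containing \<open>xs\<close>.\<close>

definition limsup_dominated :: "(nat \<Rightarrow> 'a::real_normed_vector) \<Rightarrow> 'a \<Rightarrow> bool" where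
  "limsup_dominated xs y \<longleftrightarrow>
     (\<forall>(\<phi> :: 'a \<Rightarrow>\<^sub>L real) c. (\<forall>\<^sub>F n in sequentially. blinfun_apply \<phi> (xs n) \<le> c) \<longrightarrow> blinfun_apply \<phi> y \<le> c)"

lemma limsup_dominatedD:
  fixes \<phi> :: "'a::real_normed_vector \<Rightarrow>\<^sub>L real"
  shows "limsup_dominated xs y \<Longrightarrow> \<forall>\<^sub>F n in sequentially. blinfun_apply \<phi> (xs n) \<le> c \<Longrightarrow> blinfun_apply \<phi> y \<le> c"
  unfolding limsup_dominated_def by blast

text \<open>The upper limit of \<open>\<phi> (xs n)\<close> is a sublinear function of \<open>\<phi>\<close>. A linear minorant of it is a
  bounded functional on the dual, hence by reflexivity the evaluation at a point.\<close>

lemma reflexive_limsup_dominated: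
  fixes xs :: "nat \<Rightarrow> 'a::real_normed_vector"
  assumes refl: "reflexive_space TYPE('a)" and bd: "bounded (range xs)"
  obtains y where "limsup_dominated xs y"
proof -
  define E where "E = (\<lambda>\<phi> :: 'a \<Rightarrow>\<^sub>L real. {c. \<forall>\<^sub>F n in sequentially. blinfun_apply \<phi> (xs n) \<le> c})"
  define p where "p = (\<lambda>\<phi>. Inf (E \<phi>))"
  obtain B where B: "\<And>n. norm (xs n) \<le> B"
    using bd unfolding bounded_iff by blast
  have "\<bar>blinfun_apply \<phi> (xs n)\<bar> \<le> B * norm \<phi>" for \<phi> :: "'a \<Rightarrow>\<^sub>L real" and n
    using norm_blinfun[of \<phi> "xs n"] mult_left_mono[OF B[of n], of "norm \<phi>"] by (simp add: mult.commute)
  hence B': "blinfun_apply \<phi> (xs n) \<le> B * norm \<phi>" "- (B * norm \<phi>) \<le> blinfun_apply \<phi> (xs n)"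
    for \<phi> :: "'a \<Rightarrow>\<^sub>L real" and n
    by (simp_all add: abs_le_iff) (metis minus_le_iff)
  have ne: "B * norm \<phi> \<in> E \<phi>" for \<phi>
    using B'(1) by (simp add: E_def)
  have low: "- (B * norm \<phi>) \<le> c" if c: "c \<in> E \<phi>" for c \<phi>
  proof -
    obtain n where "blinfun_apply \<phi> (xs n) \<le> c"
      using c unfolding E_def eventually_sequentially by auto
    thus ?thesis using B'(2)[of \<phi> n] by simp
  qed
  have p_le: "p \<phi> \<le> c" if "c \<in> E \<phi>" for c \<phi>
    unfolding p_def using that low by (intro cInf_lower bdd_belowI[of _ "- (B * norm \<phi>)"]) auto
  have p_gr: "b \<le> p \<phi>" if "\<And>c. c \<in> E \<phi> \<Longrightarrow> b \<le> c" for b \<phi>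
    unfolding p_def using that ne by (intro cInf_greatest) auto
  have "sublinear p"
  proof (rule sublinearI)
    fix \<phi> \<psi>
    have "p (\<phi> + \<psi>) - c \<le> d" if "c \<in> E \<phi>" "d \<in> E \<psi>" for c d
    proof -
      have "c + d \<in> E (\<phi> + \<psi>)"
        using that unfolding E_def mem_Collect_eq blinfun.add_left
        by (blast intro: eventually_elim2 add_mono)
      thus ?thesis using p_le by fastforce
    qed
    hence "p (\<phi> + \<psi>) - c \<le> p \<psi>" if "c \<in> E \<phi>" for c
      by (rule p_gr) (use that in auto)
    hence "p (\<phi> + \<psi>) - p \<psi> \<le> c" if "c \<in> E \<phi>" for c
      using that by (simp add: algebra_simps)
    hence "p (\<phi> + \<psi>) - p \<psi> \<le> p \<phi>" by (rule p_gr)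
    thus "p (\<phi> + \<psi>) \<le> p \<phi> + p \<psi>" by simp
  next
    fix c :: real and \<phi>
    assume "c \<ge> 0"
    show "p (c *\<^sub>R \<phi>) \<le> c * p \<phi>"
    proof (cases "c = 0")
      case True
      then show ?thesis using p_le[OF ne[of 0]] by simp
    next
      case False
      with \<open>c \<ge> 0\<close> have "c > 0" by simp
      have "p (c *\<^sub>R \<phi>) / c \<le> d" if "d \<in> E \<phi>" for d
      proof -
        have "c * d \<in> E (c *\<^sub>R \<phi>)"
          using that \<open>c > 0\<close> unfolding E_def by (auto simp: blinfun.scaleR_left)
        thus ?thesis using p_le[of "c * d"] \<open>c > 0\<close> by (simp add: field_simps)
      qed
      hence "p (c *\<^sub>R \<phi>) / c \<le> p \<phi>" by (rule p_gr)
      thus ?thesis using \<open>c > 0\<close> by (simp add: field_simps)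
    qed
  qed
  then obtain f where f: "linear f" "\<And>\<phi>. f \<phi> \<le> p \<phi>"
    using hahn_banach_sublinear by blast
  have "f \<phi> \<le> B * norm \<phi>" for \<phi>
    using f(2)[of \<phi>] p_le[OF ne[of \<phi>]] by simp
  then obtain \<Phi> :: "('a \<Rightarrow>\<^sub>L real) \<Rightarrow>\<^sub>L real" where \<Phi>: "blinfun_apply \<Phi> = f"
    using dominated_linear_blinfun[OF f(1)] by blast
  then obtain y where "\<And>\<phi>. blinfun_apply \<phi> y = f \<phi>"
    using refl unfolding reflexive_space_def by metis
  hence "blinfun_apply \<phi> y \<le> c" if "\<forall>\<^sub>F n in sequentially. blinfun_apply \<phi> (xs n) \<le> c" for \<phi> :: "'a \<Rightarrow>\<^sub>L real" and c
    using f(2)[of \<phi>] p_le[of c \<phi>] that by (simp add: E_def)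
  hence "limsup_dominated xs y" unfolding limsup_dominated_def by blast
  thus ?thesis by (rule that)
qed

lemma limsup_dominated_LIMSEQ:
  fixes \<phi> :: "'a::real_normed_vector \<Rightarrow>\<^sub>L real"
  assumes y: "limsup_dominated xs y"
    and lim: "(\<lambda>n. blinfun_apply \<phi> (xs n)) \<longlonglongrightarrow> a"
  shows "blinfun_apply \<phi> y = a"
proof (rule antisym)
  have upper: "blinfun_apply \<psi> y \<le> b" if "(\<lambda>n. blinfun_apply \<psi> (xs n)) \<longlonglongrightarrow> b" for \<psi> :: "'a \<Rightarrow>\<^sub>L real" and b
  proof (rule field_le_epsilon)
    fix e :: real assume "e > 0"
    hence "\<forall>\<^sub>F n in sequentially. blinfun_apply \<psi> (xs n) < b + e"
      using that by (intro order_tendstoD) auto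
    thus "blinfun_apply \<psi> y \<le> b + e"
      by (intro limsup_dominatedD[OF y]) (auto elim: eventually_mono)
  qed
  show "blinfun_apply \<phi> y \<le> a" by (rule upper[OF lim])
  have "(\<lambda>n. blinfun_apply (- \<phi>) (xs n)) \<longlonglongrightarrow> - a"
    using tendsto_minus[OF lim] by (simp add: blinfun.minus_left)
  thus "a \<le> blinfun_apply \<phi> y"
    using upper[of "- \<phi>" "- a"] by (simp add: blinfun.minus_left)
qed

text \<open>The sequence lives in a separable closed subspace, on which countably many norming functionals
  separate points. A diagonal subsequence makes all of them converge. Two points that are dominated
  along subsequences of it agree on these functionals, hence coincide; so any other
  functional has only one possible limit along subsequences.\<close>

theorem reflexive_bounded_weak_subsequence:
  fixes xs :: "nat \<Rightarrow> 'a::real_normed_vector"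
  assumes refl: "reflexive_space TYPE('a)" and bd: "bounded (range xs)"
  obtains r :: "nat \<Rightarrow> nat" and y where "strict_mono r" "(\<lambda>n. xs (r n)) \<rightharpoonup> y"
proof -
  obtain d :: "nat \<Rightarrow> 'a" where d: "subspace (closure (range d))" "range xs \<subseteq> range d"
    using countable_dense_subspace[of xs] .
  have "\<forall>k. \<exists>\<phi> :: 'a \<Rightarrow>\<^sub>L real. blinfun_apply \<phi> (d k) = norm (d k) \<and> (\<forall>x. \<bar>blinfun_apply \<phi> x\<bar> \<le> norm x)"
  proof
    fix k
    show "\<exists>\<phi> :: 'a \<Rightarrow>\<^sub>L real. blinfun_apply \<phi> (d k) = norm (d k) \<and> (\<forall>x. \<bar>blinfun_apply \<phi> x\<bar> \<le> norm x)"
      using norming_functional[of "d k"] by blast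
  qed
  from choice[OF this] obtain \<psi> :: "nat \<Rightarrow> 'a \<Rightarrow>\<^sub>L real" where \<psi>: "\<And>k. blinfun_apply (\<psi> k) (d k) = norm (d k)"
      "\<And>k x. \<bar>blinfun_apply (\<psi> k) x\<bar> \<le> norm x"
    by blast
  have sub_bd: "bounded (range (\<lambda>n. xs (s n)))" for s :: "nat \<Rightarrow> nat"
    using bd by (rule bounded_subset) auto
  have subseq: "\<exists>r. strict_mono r \<and> convergent (\<lambda>n. blinfun_apply \<phi> (xs (s (r n))))"
    for \<phi> :: "'a \<Rightarrow>\<^sub>L real" and s :: "nat \<Rightarrow> nat"
  proof -
    have "bounded (range (\<lambda>n. blinfun_apply \<phi> (xs (s n))))"
      using bounded_linear_image[OF sub_bd[of s] blinfun.bounded_linear_right[of \<phi>]]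
      by (simp add: image_image)
    from bounded_imp_convergent_subsequence[OF this] show ?thesis
      unfolding convergent_def o_def by blast
  qed
  interpret subseqs "\<lambda>k s. convergent (\<lambda>n. blinfun_apply (\<psi> k) (xs (s n)))"
    by standard (use subseq in \<open>simp add: o_def\<close>)
  have conv: "convergent (\<lambda>n. blinfun_apply (\<psi> k) (xs (diagseq n)))" for k
  proof -
    have "convergent (\<lambda>n. blinfun_apply (\<psi> k) (xs ((diagseq \<circ> (+) (Suc k)) n)))"
    proof (rule diagseq_holds)
      fix r s :: "nat \<Rightarrow> nat" and n
      assume "strict_mono r" "convergent (\<lambda>i. blinfun_apply (\<psi> n) (xs (s i)))"
      thus "convergent (\<lambda>i. blinfun_apply (\<psi> n) (xs ((s \<circ> r) i)))"
        using convergent_subseq_convergent[of "\<lambda>i. blinfun_apply (\<psi> n) (xs (s i))" r]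
        by (simp add: o_def)
    qed
    then obtain b where "(\<lambda>n. blinfun_apply (\<psi> k) (xs (diagseq (n + Suc k)))) \<longlonglongrightarrow> b"
      unfolding convergent_def by (auto simp: o_def add.commute)
    from LIMSEQ_offset[where f = "\<lambda>n. blinfun_apply (\<psi> k) (xs (diagseq n))", OF this]
    show ?thesis by (auto simp: convergent_def)
  qed
  have in_closure: "y \<in> closure (range d)"
    if y: "limsup_dominated (\<lambda>n. xs (s n)) y" for y s
  proof (rule ccontr)
    assume "y \<notin> closure (range d)"
    then obtain \<phi> :: "'a \<Rightarrow>\<^sub>L real" where \<phi>: "\<And>z. z \<in> closure (range d) \<Longrightarrow> blinfun_apply \<phi> z = 0"
        "blinfun_apply \<phi> y > 0"
      using separating_functional_subspace[OF d(1), of y] by (metis closure_closure)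
    have "xs n \<in> closure (range d)" for n
      using d(2) closure_subset[of "range d"] by (meson rangeI subsetD)
    hence "blinfun_apply \<phi> (xs n) = 0" for n
      by (rule \<phi>(1))
    hence "\<forall>\<^sub>F n in sequentially. blinfun_apply \<phi> (xs (s n)) \<le> 0" by simp
    thus False using limsup_dominatedD[OF y, of \<phi> 0] \<phi>(2) by linarith
  qed
  obtain y where y: "limsup_dominated (\<lambda>n. xs (diagseq n)) y"
    using reflexive_limsup_dominated[OF refl sub_bd[of diagseq]] .
  have "(\<lambda>n. xs (diagseq n)) \<rightharpoonup> y"
    unfolding weak_LIMSEQ_def
  proof (intro allI LIMSEQ_if_subsequences)
    fix \<phi> :: "'a \<Rightarrow>\<^sub>L real" and s :: "nat \<Rightarrow> nat"
    assume s: "strict_mono s"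
    obtain r a where r: "strict_mono r"
      and a: "(\<lambda>n. blinfun_apply \<phi> (xs (diagseq (s (r n))))) \<longlonglongrightarrow> a"
      using subseq[of \<phi> "\<lambda>n. diagseq (s n)"] unfolding convergent_def by blast
    obtain y' where y': "limsup_dominated (\<lambda>n. xs (diagseq (s (r n)))) y'"
      using reflexive_limsup_dominated[OF refl sub_bd[of "\<lambda>n. diagseq (s (r n))"]] .
    have agree: "blinfun_apply (\<psi> k) y' = blinfun_apply (\<psi> k) y" for k
    proof -
      obtain b where b: "(\<lambda>n. blinfun_apply (\<psi> k) (xs (diagseq n))) \<longlonglongrightarrow> b"
        using conv[of k] unfolding convergent_def by blast
      have "(\<lambda>n. blinfun_apply (\<psi> k) (xs (diagseq (s (r n))))) \<longlonglongrightarrow> b"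
        using LIMSEQ_subseq_LIMSEQ[OF b strict_mono_o[OF s r]] by (simp add: o_def)
      thus ?thesis
        using limsup_dominated_LIMSEQ[OF y b] limsup_dominated_LIMSEQ[OF y', of "\<psi> k" b] by simp
    qed
    have diff: "y' - y \<in> closure (range d)"
      by (rule subspace_diff[OF d(1) in_closure[OF y'] in_closure[OF y]])
    \<comment> \<open>All norming functionals vanish at the difference, although one of them
      nearly norms it.\<close>
    have "y' = y"
    proof (rule ccontr)
      assume "y' \<noteq> y"
      hence "norm (y' - y) / 2 > 0" by simp
      then obtain k where k: "dist (d k) (y' - y) < norm (y' - y) / 2"
        using diff unfolding closure_approachable by blast
      have "norm (d k) = blinfun_apply (\<psi> k) (d k - (y' - y))"
        using \<psi>(1)[of k] agree[of k] by (simp add: blinfun.diff_right)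
      also have "\<dots> \<le> norm (d k - (y' - y))"
        using \<psi>(2)[of k "d k - (y' - y)"] by simp
      finally show False
        using k norm_triangle_ineq2[of "y' - y" "d k"] by (simp add: dist_norm norm_minus_commute)
    qed
    moreover have "blinfun_apply \<phi> y' = a"
      by (rule limsup_dominated_LIMSEQ[OF y' a])
    ultimately show "\<exists>r. strict_mono r \<and>
        ((\<lambda>n. blinfun_apply \<phi> (xs (diagseq n))) \<circ> s \<circ> r) \<longlonglongrightarrow> blinfun_apply \<phi> y"
      using r a by (auto simp: o_def)
  qed
  thus ?thesis using that subseq_diagseq by blast
qed

section \<open>Growth estimates\<close>

text \<open>Gronwall's inequality for the integral: \<open>(a + b * integral {0..s} g) * exp (- b * s)\<close> is
  nonincreasing in \<open>s\<close>.\<close>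

lemma gronwall:
  fixes g :: "real \<Rightarrow> real"
  assumes g: "continuous_on {0..T} g" and b: "b \<ge> 0"
    and le: "\<And>t. t \<in> {0..T} \<Longrightarrow> g t \<le> a + b * integral {0..t} g"
    and t: "t \<in> {0..T}"
  shows "g t \<le> a * exp (b * t)"
proof -
  define H where "H = (\<lambda>s. (a + b * integral {0..s} g) * exp (- (b * s)))"
  have deriv: "(H has_real_derivative b * (g s - (a + b * integral {0..s} g)) * exp (- (b * s)))
      (at s within {0..T})" if s: "s \<in> {0..T}" for s
  proof -
    have "((\<lambda>s. a + b * integral {0..s} g) has_real_derivative b * g s) (at s within {0..T})"
      by (auto intro!: derivative_eq_intros integral_has_real_derivative[OF g s])
    moreover have "((\<lambda>s. exp (- (b * s))) has_real_derivative - b * exp (- (b * s))) (at s within {0..T})"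
      by (auto intro!: derivative_eq_intros)
    ultimately have "(H has_real_derivative b * g s * exp (- (b * s))
        + - b * exp (- (b * s)) * (a + b * integral {0..s} g)) (at s within {0..T})"
      unfolding H_def by (rule DERIV_mult)
    thus ?thesis by (simp add: algebra_simps)
  qed
  have "H t \<le> H 0"
  proof (rule DERIV_nonpos_imp_decreasing_open[where f = H])
    fix s assume s: "0 < s" "s < t"
    hence "at s within {0..T} = at s" using t by (intro at_within_Icc_at) auto
    hence "DERIV H s :> b * (g s - (a + b * integral {0..s} g)) * exp (- (b * s))"
      using deriv[of s] s t by simp
    moreover have "b * (g s - (a + b * integral {0..s} g)) * exp (- (b * s)) \<le> 0"
      using le[of s] b s t by (intro mult_nonpos_nonneg mult_nonneg_nonpos) auto
    ultimately show "\<exists>y. DERIV H s :> y \<and> y \<le> 0" by blast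
  next
    have "continuous_on {0..T} H"
      using deriv by (meson DERIV_continuous continuous_on_eq_continuous_within)
    thus "continuous_on {0..t} H" using t by (auto intro: continuous_on_subset)
  qed (use t in auto)
  hence "a + b * integral {0..t} g \<le> a * exp (b * t)"
    by (simp add: H_def exp_minus field_simps)
  thus ?thesis using le[OF t] by simp
qed

lemma gronwall_forced:
  fixes g h :: "real \<Rightarrow> real"
  assumes g: "continuous_on {0..T} g" and h: "continuous_on {0..T} h" "\<And>t. t \<in> {0..T} \<Longrightarrow> h t \<ge> 0"
    and b: "b \<ge> 0"
    and le: "\<And>t. t \<in> {0..T} \<Longrightarrow> g t \<le> a + integral {0..t} (\<lambda>s. h s + b * g s)"
    and t: "t \<in> {0..T}"
  shows "g t \<le> (a + integral {0..T} h) * exp (b * t)"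
proof (rule gronwall[OF g b _ t])
  fix r assume r: "r \<in> {0..T}"
  hence sub: "{0..r} \<subseteq> {0..T}" by auto
  have int: "h integrable_on {0..r}" "g integrable_on {0..r}" "h integrable_on {0..T}"
    using continuous_on_subset[OF g sub] continuous_on_subset[OF h(1) sub] h(1)
    by (auto intro: integrable_continuous_real)
  have "integral {0..r} (\<lambda>s. h s + b * g s) = integral {0..r} h + b * integral {0..r} g"
    using integral_add[OF int(1) integrable_cmul[OF int(2), of b]] by simp
  moreover have "integral {0..r} h \<le> integral {0..T} h"
    using int sub h(2) by (intro integral_subset_le) auto
  ultimately show "g r \<le> a + integral {0..T} h + b * integral {0..r} g"
    using le[OF r] by simp
qed

text \<open>Derivatives are Henstock--Kurzweil integrable, so a continuous bound on their difference
  suffices.\<close>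

lemma norm_diff_le_integral_derivative:
  fixes x y :: "real \<Rightarrow> 'a::banach"
  assumes x: "\<And>t. t \<in> {0..T} \<Longrightarrow> (x has_vector_derivative x' t) (at t within {0..T})"
    and y: "\<And>t. t \<in> {0..T} \<Longrightarrow> (y has_vector_derivative y' t) (at t within {0..T})"
    and k: "continuous_on {0..T} k" and le: "\<And>t. t \<in> {0..T} \<Longrightarrow> norm (x' t - y' t) \<le> k t"
    and t: "t \<in> {0..T}"
  shows "norm (x t - y t) \<le> norm (x 0 - y 0) + integral {0..t} k"
proof -
  have sub: "{0..t} \<subseteq> {0..T}" using t by auto
  have int: "((\<lambda>s. x' s - y' s) has_integral (x t - y t) - (x 0 - y 0)) {0..t}"
  proof (rule fundamental_theorem_of_calculus)
    fix s assume "s \<in> {0..t}"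
    hence "((\<lambda>s. x s - y s) has_vector_derivative x' s - y' s) (at s within {0..T})"
      using sub by (intro has_vector_derivative_diff x y) auto
    thus "((\<lambda>s. x s - y s) has_vector_derivative x' s - y' s) (at s within {0..t})"
      by (rule has_vector_derivative_within_subset[OF _ sub])
  qed (use t in auto)
  have "norm (integral {0..t} (\<lambda>s. x' s - y' s)) \<le> integral {0..t} k"
    using int sub le continuous_on_subset[OF k sub]
    by (intro integral_norm_bound_integral) (auto intro: integrable_continuous_real)
  hence "norm ((x t - y t) - (x 0 - y 0)) \<le> integral {0..t} k"
    using integral_unique[OF int] by simp
  thus ?thesis
    using norm_triangle_ineq[of "x 0 - y 0" "(x t - y t) - (x 0 - y 0)"] by simp
qed

section \<open>Variational inequalities\<close>

lemma le_limsup_bound: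
  fixes R J :: "nat \<Rightarrow> real"
  assumes "R \<longlonglongrightarrow> r" and "\<And>n. R n \<le> J n" and "limsup (\<lambda>n. ereal (J n)) \<le> ereal c"
  shows "r \<le> c"
proof -
  have "limsup (\<lambda>n. ereal (R n)) = ereal r"
    using assms(1) by (intro lim_imp_Limsup) auto
  moreover have "limsup (\<lambda>n. ereal (R n)) \<le> limsup (\<lambda>n. ereal (J n))"
    using assms(2) by (intro Limsup_mono) auto
  ultimately show ?thesis using assms(3) by (metis ereal_less_eq(3) order_trans)
qed

text \<open>A priori bound for a solution \<open>u\<close> of a variational inequality by data at one test point \<open>w\<close>.
  The growth rate \<open>\<delta>\<close> of \<open>j\<close> in \<open>u\<close> is absorbed by the strong monotonicity \<open>m\<close>.\<close>

lemma vi_solution_bound: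
  fixes A :: "'v::real_normed_vector \<Rightarrow> 'v \<Rightarrow>\<^sub>L real" and \<pi> :: "'v \<Rightarrow> 'z::real_inner"
  assumes vi: "blinfun_apply (A u) (w - u) + j w - j u \<ge> inner f (\<pi> w - \<pi> u)"
    and mono: "blinfun_apply (A u - A w) (u - w) \<ge> m * (norm (u - w))\<^sup>2"
    and j: "j w - j u \<le> (\<tau> + \<delta> * (a + norm u)) * norm (w - u)"
    and \<pi>: "norm (\<pi> u - \<pi> w) \<le> p * norm (u - w)"
    and pos: "\<tau> \<ge> 0" "\<delta> \<ge> 0" "a \<ge> 0" "p \<ge> 0"
  shows "(m - \<delta>) * norm (u - w) \<le> norm (A w) + p * norm f + \<tau> + \<delta> * (a + norm w)"
proof (cases "u = w")
  case True
  then show ?thesis using pos by simp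
next
  case False
  hence "norm (u - w) > 0" by simp
  have "blinfun_apply (A u) (w - u) = - blinfun_apply (A u) (u - w)"
    by (metis blinfun.minus_right minus_diff_eq)
  moreover have "inner f (\<pi> w - \<pi> u) = - inner f (\<pi> u - \<pi> w)"
    by (simp add: inner_diff_right)
  ultimately have "m * (norm (u - w))\<^sup>2
      \<le> j w - j u + inner f (\<pi> u - \<pi> w) - blinfun_apply (A w) (u - w)"
    using mono vi by (simp add: blinfun.diff_left)
  also have "\<dots> \<le> (\<tau> + \<delta> * (a + norm u)) * norm (u - w) + norm f * (p * norm (u - w)) + norm (A w) * norm (u - w)"
  proof -
    have "inner f (\<pi> u - \<pi> w) \<le> norm f * (p * norm (u - w))"
      by (rule order_trans[OF norm_cauchy_schwarz mult_left_mono[OF \<pi>]]) simp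
    moreover have "- blinfun_apply (A w) (u - w) \<le> norm (A w) * norm (u - w)"
      using norm_blinfun[of "A w" "u - w"] by simp
    ultimately show ?thesis using j by (simp add: norm_minus_commute)
  qed
  also have "\<dots> = (\<tau> + \<delta> * (a + norm u) + p * norm f + norm (A w)) * norm (u - w)"
    by (simp add: algebra_simps)
  finally have "m * norm (u - w) \<le> \<tau> + \<delta> * (a + norm u) + p * norm f + norm (A w)"
    using \<open>norm (u - w) > 0\<close> by (simp add: power2_eq_square mult.assoc[symmetric])
  moreover have "\<delta> * norm u \<le> \<delta> * (norm w + norm (u - w))"
    using pos norm_triangle_ineq[of w "u - w"] by (intro mult_left_mono) auto
  ultimately show ?thesis by (simp add: algebra_simps)
qed

text \<open>Comparison of \<open>un n\<close>, solving the \<open>n\<close>-th inequality with parameter \<open>xn n\<close>, to \<open>u\<close>, solving the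
  limit inequality with parameter \<open>x\<close>, when \<open>xn n\<close> need not converge to \<open>x\<close>: asymptotically the gap of
  the solutions is at most \<open>(L' + \<alpha>) / (m - \<beta>)\<close> times the gap of the parameters. The \<open>n\<close>-th inequality
  is tested with a strong approximation \<open>vs n\<close> of \<open>u\<close>, the limit inequality with the weak limit \<open>b\<close> of
  \<open>un\<close>, which the Mosco limit \<open>K\<close> contains. The two values of \<open>j\<close> at \<open>b\<close> and \<open>u\<close> left in the limit are
  controlled by \<open>\<beta> * norm (b - u)^2\<close>, and \<open>norm (b - u) \<le> s\<close> by weak lower semicontinuity.\<close>

lemma vi_gap:
  fixes An :: "nat \<Rightarrow> 'x::real_normed_vector \<Rightarrow> 'v::real_normed_vector \<Rightarrow> 'v \<Rightarrow>\<^sub>L real"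
    and \<pi> :: "'v \<Rightarrow> 'z::real_inner"
  assumes \<pi>_compl: "\<And>vs v. vs \<rightharpoonup> v \<Longrightarrow> (\<lambda>n. \<pi> (vs n)) \<longlonglongrightarrow> \<pi> v"
    and u: "u \<in> K"
    and vi: "\<And>v. v \<in> K \<Longrightarrow> blinfun_apply (A x u) (v - u) + j x u v - j x u u \<ge> inner f (\<pi> v - \<pi> u)"
    and un: "\<And>n. un n \<in> Kn n"
    and vin: "\<And>n v. v \<in> Kn n \<Longrightarrow>
      blinfun_apply (An n (xn n) (un n)) (v - un n) + jn n (xn n) (un n) v - jn n (xn n) (un n) (un n)
        \<ge> inner (fn n) (\<pi> v - \<pi> (un n))"
    and mono: "\<And>u1 u2. blinfun_apply (A x u1 - A x u2) (u1 - u2) \<ge> m * (norm (u1 - u2))\<^sup>2"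
    and lip: "\<And>u1 u2. norm (A x u1 - A x u2) \<le> L'' * norm (u1 - u2)"
    and j: "\<And>u1 u2 v1 v2. j x u1 v2 - j x u1 v1 + j x u2 v1 - j x u2 v2
        \<le> \<beta> * norm (u1 - u2) * norm (v1 - v2)"
    and lipn: "\<And>n x1 x2 w. norm (An n x1 w - An n x2 w) \<le> L' * norm (x1 - x2)"
    and jn: "\<And>n x1 x2 w v1 v2. jn n x1 w v2 - jn n x1 w v1 + jn n x2 w v1 - jn n x2 w v2
        \<le> \<alpha> * norm (x1 - x2) * norm (v1 - v2)"
    and Alim: "(\<lambda>n. norm (An n x (un n) - A x (un n))) \<longlonglongrightarrow> 0"
    and jlim: "\<And>vs b v. un \<rightharpoonup> b \<Longrightarrow> vs \<rightharpoonup> v \<Longrightarrow>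
        limsup (\<lambda>n. ereal (jn n x (un n) (vs n) - jn n x (un n) (un n))) \<le> ereal (j x b v - j x b b)"
    and mosco: "mosco_converges Kn K"
    and flim: "fn \<rightharpoonup> f" and fbd: "\<And>n. norm (fn n) \<le> w"
    and weak: "un \<rightharpoonup> b"
    and dlim: "(\<lambda>n. norm (xn n - x)) \<longlonglongrightarrow> d"
    and slim: "(\<lambda>n. norm (un n - u)) \<longlonglongrightarrow> s"
    and nonneg: "L' \<ge> 0" "L'' \<ge> 0" "\<alpha> \<ge> 0" "\<beta> \<ge> 0"
  shows "(m - \<beta>) * s \<le> (L' + \<alpha>) * d"
proof -
  have "b \<in> K"
    using mosco un weak unfolding mosco_converges_def by blast
  obtain vs where vs: "\<And>n. vs n \<in> Kn n" "vs \<longlonglongrightarrow> u"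
    using mosco u unfolding mosco_converges_def by blast
  define a where "a = (\<lambda>n. norm (An n x (un n) - A x (un n)))"
  define sn where "sn = (\<lambda>n. norm (un n - u))"
  define dn where "dn = (\<lambda>n. norm (xn n - x))"
  define gn where "gn = (\<lambda>n. norm (vs n - u))"
  have gn: "gn \<longlonglongrightarrow> 0"
    unfolding gn_def using vs(2) by (simp add: tendsto_norm_zero LIM_zero)
  \<comment> \<open>A lower bound for the increment of \<open>jn\<close> that collects all terms having a limit.\<close>
  define R where "R = (\<lambda>n. m * (sn n)\<^sup>2 - a n * sn n - (a n + L'' * sn n + norm (A x u)) * gn n
      - (L' + \<alpha>) * dn n * (sn n + gn n) + inner (fn n) (\<pi> (vs n) - \<pi> (un n))
      + blinfun_apply (A x u) (un n - u))"
  have "R n \<le> jn n x (un n) (vs n) - jn n x (un n) (un n)" for n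
  proof -
    have split: "norm (un n - vs n) \<le> sn n + gn n"
      unfolding sn_def gn_def using norm_triangle_ineq4[of "un n - u" "vs n - u"] by simp
    have pos: "dn n \<ge> 0" "sn n \<ge> 0" "gn n \<ge> 0" "a n \<ge> 0" by (simp_all add: dn_def sn_def gn_def a_def)
    have 1: "m * (sn n)\<^sup>2 \<le> blinfun_apply (A x (un n)) (un n - u) - blinfun_apply (A x u) (un n - u)"
      using mono[of "un n" u] by (simp add: sn_def blinfun.diff_left)
    have 2: "blinfun_apply (A x (un n)) (un n - u) - blinfun_apply (An n x (un n)) (un n - u) \<le> a n * sn n"
      using norm_blinfun[of "A x (un n) - An n x (un n)" "un n - u"]
      by (simp add: a_def sn_def blinfun.diff_left norm_minus_commute)
    have 3: "blinfun_apply (An n x (un n)) (un n - u)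
        = blinfun_apply (An n x (un n)) (un n - vs n) + blinfun_apply (An n x (un n)) (vs n - u)"
      by (simp add: blinfun.diff_right)
    have 4: "blinfun_apply (An n x (un n)) (vs n - u) \<le> (a n + L'' * sn n + norm (A x u)) * gn n"
    proof -
      have "norm (An n x (un n)) \<le> norm (An n x (un n) - A x (un n)) + norm (A x (un n) - A x u) + norm (A x u)"
        by norm
      hence "norm (An n x (un n)) \<le> a n + L'' * sn n + norm (A x u)"
        using lip[of "un n" u] by (simp add: a_def sn_def)
      hence "norm (An n x (un n)) * gn n \<le> (a n + L'' * sn n + norm (A x u)) * gn n"
        using pos by (intro mult_right_mono)
      thus ?thesis using norm_blinfun[of "An n x (un n)" "vs n - u"] by (simp add: gn_def)
    qed
    have 5: "blinfun_apply (An n x (un n)) (un n - vs n)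
        - blinfun_apply (An n (xn n) (un n)) (un n - vs n) \<le> L' * dn n * (sn n + gn n)"
    proof -
      have "blinfun_apply (An n x (un n) - An n (xn n) (un n)) (un n - vs n)
          \<le> norm (An n x (un n) - An n (xn n) (un n)) * norm (un n - vs n)"
        using norm_blinfun[of "An n x (un n) - An n (xn n) (un n)" "un n - vs n"] by simp
      also have "\<dots> \<le> (L' * dn n) * (sn n + gn n)"
        using lipn[of n x "un n" "xn n"] split pos nonneg
        by (intro mult_mono) (simp_all add: dn_def norm_minus_commute)
      finally show ?thesis by (simp add: blinfun.diff_left)
    qed
    have 6: "blinfun_apply (An n (xn n) (un n)) (un n - vs n)
        \<le> jn n (xn n) (un n) (vs n) - jn n (xn n) (un n) (un n) - inner (fn n) (\<pi> (vs n) - \<pi> (un n))"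
      using vin[OF vs(1)[of n]] by (simp add: blinfun.diff_right)
    have 7: "jn n (xn n) (un n) (vs n) - jn n (xn n) (un n) (un n)
        \<le> jn n x (un n) (vs n) - jn n x (un n) (un n) + \<alpha> * dn n * (sn n + gn n)"
    proof -
      have "\<alpha> * dn n * norm (un n - vs n) \<le> \<alpha> * dn n * (sn n + gn n)"
        using split pos nonneg by (intro mult_left_mono) auto
      thus ?thesis using jn[of n "xn n" "un n" "vs n" "un n" x] by (simp add: dn_def)
    qed
    show ?thesis
      using 1 2 3 4 5 6 7 by (simp add: R_def algebra_simps)
  qed
  moreover have "R \<longlonglongrightarrow> m * s\<^sup>2 - 0 * s - (0 + L'' * s + norm (A x u)) * 0
      - (L' + \<alpha>) * d * (s + 0) + inner f (\<pi> u - \<pi> b) + blinfun_apply (A x u) (b - u)"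
  proof -
    have pi: "(\<lambda>n. \<pi> (vs n) - \<pi> (un n)) \<longlonglongrightarrow> \<pi> u - \<pi> b"
      by (intro tendsto_diff \<pi>_compl weak LIMSEQ_imp_weak vs)
    have "(\<lambda>n. inner (fn n) (\<pi> (vs n) - \<pi> (un n))) \<longlonglongrightarrow> inner f (\<pi> u - \<pi> b)"
      by (rule inner_weak_strong_LIMSEQ[OF flim fbd pi])
    moreover have "(\<lambda>n. blinfun_apply (A x u) (un n - u)) \<longlonglongrightarrow> blinfun_apply (A x u) (b - u)"
      unfolding blinfun.diff_right by (intro tendsto_diff tendsto_const weak_LIMSEQ_blinfun weak)
    moreover have "a \<longlonglongrightarrow> 0" "sn \<longlonglongrightarrow> s" "dn \<longlonglongrightarrow> d"
      using Alim slim dlim by (simp_all add: a_def sn_def dn_def)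
    ultimately show ?thesis
      unfolding R_def using gn
      by (intro tendsto_add tendsto_diff tendsto_mult tendsto_power tendsto_const)
  qed
  moreover have "limsup (\<lambda>n. ereal (jn n x (un n) (vs n) - jn n x (un n) (un n)))
      \<le> ereal (j x b u - j x b b)"
    by (intro jlim weak LIMSEQ_imp_weak vs)
  ultimately have "m * s\<^sup>2 - (L' + \<alpha>) * d * s + inner f (\<pi> u - \<pi> b) + blinfun_apply (A x u) (b - u)
      \<le> j x b u - j x b b"
    using le_limsup_bound by fastforce
  moreover have "blinfun_apply (A x u) (b - u) + j x u b - j x u u \<ge> - inner f (\<pi> u - \<pi> b)"
    using vi[OF \<open>b \<in> K\<close>] by (simp add: inner_diff_right)
  moreover have "j x b u - j x b b + j x u b - j x u u \<le> \<beta> * norm (b - u) * norm (b - u)"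
    by (rule j)
  moreover have "\<beta> * norm (b - u) * norm (b - u) \<le> \<beta> * s * s"
  proof -
    have "norm (b - u) \<le> s" by (rule weak_LIMSEQ_norm_le[OF weak slim])
    moreover from this have "0 \<le> s" by (rule order_trans[OF norm_ge_zero])
    ultimately show ?thesis using nonneg by (intro mult_mono) auto
  qed
  ultimately have ineq: "((m - \<beta>) * s) * s \<le> ((L' + \<alpha>) * d) * s"
    by (simp add: power2_eq_square algebra_simps)
  have "s \<ge> 0" "d \<ge> 0"
    using LIMSEQ_le_const[OF slim] LIMSEQ_le_const[OF dlim] by auto
  show ?thesis
  proof (cases "s = 0")
    case True
    then show ?thesis using nonneg \<open>d \<ge> 0\<close> by simp
  next
    case False
    with \<open>s \<ge> 0\<close> have "s > 0" by simp
    with ineq show ?thesis by (simp only: mult_le_cancel_right_pos)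
  qed
qed

section \<open>Dependence of the solution on the control\<close>

text \<open>The hypotheses on the data and on the solutions, for all weakly convergent sequences of controls;
  passing to subsequences of controls therefore preserves them.\<close>

locale controlled_family =
  fixes I :: "real set"
    and \<pi> :: "'v::banach \<Rightarrow> 'z::{real_inner, complete_space}"
    and U :: "'w::banach set"
    and F :: "'w \<Rightarrow> real \<Rightarrow> 'x::banach \<Rightarrow> 'v \<Rightarrow> 'x"
    and x0 :: "'w \<Rightarrow> 'x"
    and K :: "'w \<Rightarrow> 'v set"
    and A :: "'w \<Rightarrow> 'x \<Rightarrow> 'v \<Rightarrow> 'v \<Rightarrow>\<^sub>L real"
    and j :: "'w \<Rightarrow> 'x \<Rightarrow> 'v \<Rightarrow> 'v \<Rightarrow> real"
    and f :: "'w \<Rightarrow> real \<Rightarrow> 'z"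
    and LJ :: "'w \<Rightarrow> real set \<Rightarrow> real"
    and L' L'' m \<alpha> \<beta> :: "'w \<Rightarrow> real"
    and x :: "'w \<Rightarrow> real \<Rightarrow> 'x"
    and u :: "'w \<Rightarrow> real \<Rightarrow> 'v"
  assumes I: "(\<exists>T>0. I = {0..T}) \<or> I = {0..}"
    and V_reflexive: "reflexive_space TYPE('v)"
    and U_closed: "closedin weak_topology U"
    and \<pi>: "bounded_linear \<pi>"
    and \<pi>_compl: "\<And>vs v. vs \<rightharpoonup> v \<Longrightarrow> (\<lambda>n. \<pi> (vs n)) \<longlonglongrightarrow> \<pi> v"
    and admissible: "\<And>q. q \<in> U \<Longrightarrow>
          admissible I (F q) (K q) (A q) (j q) (f q) (LJ q) (L' q) (L'' q) (m q) (\<alpha> q) (\<beta> q)"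
    and solution: "\<And>q. q \<in> U \<Longrightarrow>
          solves_P I \<pi> (F q) (x0 q) (K q) (A q) (j q) (f q) (x q) (u q)"
    and constants: "\<And>qs q. (\<forall>n. qs n \<in> U) \<Longrightarrow> qs \<rightharpoonup> q \<Longrightarrow>
      (\<forall>n. (\<forall>J. compact J \<and> J \<subseteq> I \<longrightarrow> LJ (qs n) J \<le> LJ q J) \<and>
           L' (qs n) \<le> L' q \<and> L'' (qs n) \<le> L'' q \<and> m (qs n) \<ge> m q \<and>
           \<alpha> (qs n) \<le> \<alpha> q \<and> \<beta> (qs n) \<le> \<beta> q)"
    and F_conv: "\<And>qs q. (\<forall>n. qs n \<in> U) \<Longrightarrow> qs \<rightharpoonup> q \<Longrightarrow>
      (\<exists>\<Gamma> \<gamma> :: nat \<Rightarrow> real.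
           (\<forall>n. \<Gamma> n \<ge> 0 \<and> \<gamma> n \<ge> 0 \<and>
              (\<forall>t\<in>I. \<forall>a b. norm (F (qs n) t a b - F q t a b) \<le> \<Gamma> n * (norm a + norm b + \<gamma> n))) \<and>
           \<Gamma> \<longlonglongrightarrow> 0 \<and> bounded (range \<gamma>))"
    and x0_conv: "\<And>qs q. (\<forall>n. qs n \<in> U) \<Longrightarrow> qs \<rightharpoonup> q \<Longrightarrow>
      (\<lambda>n. x0 (qs n)) \<longlonglongrightarrow> x0 q"
    and K_conv: "\<And>qs q. (\<forall>n. qs n \<in> U) \<Longrightarrow> qs \<rightharpoonup> q \<Longrightarrow>
      mosco_converges (\<lambda>n. K (qs n)) (K q)"
    and A_conv: "\<And>qs q. (\<forall>n. qs n \<in> U) \<Longrightarrow> qs \<rightharpoonup> q \<Longrightarrow>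
      (\<exists>\<Lambda> l :: nat \<Rightarrow> real.
           (\<forall>n. \<Lambda> n \<ge> 0 \<and> l n \<ge> 0 \<and>
              (\<forall>a b. norm (A (qs n) a b - A q a b) \<le> \<Lambda> n * (norm a + norm b + l n))) \<and>
           \<Lambda> \<longlonglongrightarrow> 0 \<and> bounded (range l))"
    and j_bound: "\<And>qs q. (\<forall>n. qs n \<in> U) \<Longrightarrow> qs \<rightharpoonup> q \<Longrightarrow>
      (\<exists>\<tau> \<delta> :: nat \<Rightarrow> real.
           (\<forall>n. \<tau> n \<ge> 0 \<and> \<delta> n \<ge> 0 \<and>
              (\<forall>a b v1 v2. j (qs n) a b v1 - j (qs n) a b v2
                 \<le> (\<tau> n + \<delta> n * (norm a + norm b)) * norm (v1 - v2))) \<and>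
           (\<exists>\<tau>0>0. \<exists>\<delta>0>0. \<forall>n. \<tau> n \<le> \<tau>0 \<and> \<delta> n \<le> \<delta>0 \<and> \<delta>0 < m q))"
    and j_limsup: "\<And>qs q. (\<forall>n. qs n \<in> U) \<Longrightarrow> qs \<rightharpoonup> q \<Longrightarrow>
      (\<forall>us vs b v. us \<rightharpoonup> b \<longrightarrow> vs \<rightharpoonup> v \<longrightarrow>
           (\<forall>a. limsup (\<lambda>n. ereal (j (qs n) a (us n) (vs n) - j (qs n) a (us n) (us n)))
                  \<le> ereal (j q a b v - j q a b b)))"
    and f_conv: "\<And>qs q. (\<forall>n. qs n \<in> U) \<Longrightarrow> qs \<rightharpoonup> q \<Longrightarrow>
      (\<forall>t\<in>I. (\<lambda>n. f (qs n) t) \<rightharpoonup> f q t) \<and>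
      (\<forall>J. compact J \<and> J \<subseteq> I \<longrightarrow> (\<exists>w>0. \<forall>n. \<forall>t\<in>J. norm (f (qs n) t) \<le> w))"
begin

lemma interval_subset: "t \<in> I \<Longrightarrow> {0..t} \<subseteq> I"
  using I by auto

lemma nonneg_I: "t \<in> I \<Longrightarrow> 0 \<le> t"
  using I by auto

lemma weak_limit_in_U: "\<forall>n. qs n \<in> U \<Longrightarrow> qs \<rightharpoonup> q \<Longrightarrow> q \<in> U"
  using weakly_closed_weak_limit[OF U_closed] by blast

lemma solutionD:
  assumes "q \<in> U"
  shows "continuous_on I (x q)" "continuous_on I (u q)" "x q 0 = x0 q"
    and "\<And>t. t \<in> I \<Longrightarrow> (x q has_vector_derivative F q t (x q t) (u q t)) (at t within I)"
    and "\<And>t. t \<in> I \<Longrightarrow> u q t \<in> K q"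
    and "\<And>t v. t \<in> I \<Longrightarrow> v \<in> K q \<Longrightarrow>
      blinfun_apply (A q (x q t) (u q t)) (v - u q t) + j q (x q t) (u q t) v - j q (x q t) (u q t) (u q t)
        \<ge> inner (f q t) (\<pi> v - \<pi> (u q t))"
proof -
  have s: "\<forall>t\<in>I. (x q has_vector_derivative F q t (x q t) (u q t)) (at t within I)"
    "continuous_on I (u q)" "x q 0 = x0 q"
    "\<forall>t\<in>I. u q t \<in> K q \<and> (\<forall>v\<in>K q.
      blinfun_apply (A q (x q t) (u q t)) (v - u q t) + j q (x q t) (u q t) v - j q (x q t) (u q t) (u q t)
        \<ge> inner (f q t) (\<pi> v - \<pi> (u q t)))"
    using solution[OF assms] unfolding solves_P_def by blast+
  show "continuous_on I (x q)"
    using s(1) by (meson continuous_on_eq_continuous_within has_vector_derivative_continuous)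
  show "continuous_on I (u q)" "x q 0 = x0 q"
    and "\<And>t. t \<in> I \<Longrightarrow> (x q has_vector_derivative F q t (x q t) (u q t)) (at t within I)"
    and "\<And>t. t \<in> I \<Longrightarrow> u q t \<in> K q"
    and "\<And>t v. t \<in> I \<Longrightarrow> v \<in> K q \<Longrightarrow>
      blinfun_apply (A q (x q t) (u q t)) (v - u q t) + j q (x q t) (u q t) v - j q (x q t) (u q t) (u q t)
        \<ge> inner (f q t) (\<pi> v - \<pi> (u q t))"
    using s by blast+
qed

lemma admissibleD:
  assumes "q \<in> U"
  shows "\<And>J. compact J \<Longrightarrow> J \<subseteq> I \<Longrightarrow> LJ q J > 0"
    and "L' q > 0" "L'' q > 0" "m q > 0" "\<alpha> q > 0" "\<beta> q > 0" "m q > \<beta> q" "K q \<noteq> {}"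
    and "\<And>J t x1 x2 u1 u2. compact J \<Longrightarrow> J \<subseteq> I \<Longrightarrow> t \<in> J \<Longrightarrow>
      norm (F q t x1 u1 - F q t x2 u2) \<le> LJ q J * (norm (x1 - x2) + norm (u1 - u2))"
    and "\<And>x1 x2 w. norm (A q x1 w - A q x2 w) \<le> L' q * norm (x1 - x2)"
    and "\<And>a u1 u2. norm (A q a u1 - A q a u2) \<le> L'' q * norm (u1 - u2)"
    and "\<And>a u1 u2. blinfun_apply (A q a u1 - A q a u2) (u1 - u2) \<ge> m q * (norm (u1 - u2))\<^sup>2"
    and "\<And>x1 x2 u1 u2 v1 v2. j q x1 u1 v2 - j q x1 u1 v1 + j q x2 u2 v1 - j q x2 u2 v2
      \<le> \<alpha> q * norm (x1 - x2) * norm (v1 - v2) + \<beta> q * norm (u1 - u2) * norm (v1 - v2)"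
  using admissible[OF assms] unfolding admissible_def by simp_all

lemma bounded_on_interval:
  assumes "continuous_on I (g :: real \<Rightarrow> 'a::real_normed_vector)" "{0..T} \<subseteq> I"
  obtains B where "B \<ge> 0" "\<And>t. t \<in> {0..T} \<Longrightarrow> norm (g t) \<le> B"
proof -
  have "bounded (g ` {0..T})"
    using assms by (intro compact_imp_bounded compact_continuous_image continuous_on_subset[OF assms(1)]) auto
  then obtain B where "\<forall>t\<in>{0..T}. norm (g t) \<le> B" unfolding bounded_iff by auto
  thus ?thesis using that[of "max B 0"] by fastforce
qed

text \<open>The test points are a sequence \<open>ws n \<in> K (qs n)\<close> converging to some point of \<open>K q\<close>; its bound and
  the bounds on the data are uniform in \<open>n\<close> and \<open>t\<close>.\<close>

lemma u_growth:
  assumes qs: "\<forall>n. qs n \<in> U" "qs \<rightharpoonup> q" and T: "{0..T} \<subseteq> I"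
  obtains P Q where "P \<ge> 0" "Q \<ge> 0"
    "\<And>n t. t \<in> {0..T} \<Longrightarrow> norm (u (qs n) t) \<le> P + Q * norm (x (qs n) t)"
proof -
  note q = weak_limit_in_U[OF qs]
  obtain v0 where "v0 \<in> K q" using admissibleD(8)[OF q] by blast
  then obtain ws where ws: "\<And>n. ws n \<in> K (qs n)" "ws \<longlonglongrightarrow> v0"
    using K_conv[OF qs] unfolding mosco_converges_def by blast
  obtain Bw where Bw: "\<And>n. norm (ws n) \<le> Bw"
    using convergent_imp_bounded[OF ws(2)] unfolding bounded_iff by auto
  obtain \<Lambda> l where A: "\<And>n. \<Lambda> n \<ge> 0" "\<And>n. l n \<ge> 0"
      "\<And>n a b. norm (A (qs n) a b - A q a b) \<le> \<Lambda> n * (norm a + norm b + l n)"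
      "\<Lambda> \<longlonglongrightarrow> 0" "bounded (range l)"
    using A_conv[OF qs] by blast
  obtain \<Lambda>b where \<Lambda>b: "\<And>n. \<Lambda> n \<le> \<Lambda>b"
    using convergent_imp_bounded[OF A(4)] unfolding bounded_iff by (auto simp: abs_le_iff)
  obtain lb where lb: "\<And>n. l n \<le> lb"
    using A(5) unfolding bounded_iff by (auto simp: abs_le_iff)
  obtain \<tau> \<delta> \<tau>0 \<delta>0 where jb: "\<And>n a b v1 v2. j (qs n) a b v1 - j (qs n) a b v2
        \<le> (\<tau> n + \<delta> n * (norm a + norm b)) * norm (v1 - v2)"
      and \<tau>\<delta>: "\<And>n. \<tau> n \<le> \<tau>0" "\<And>n. \<delta> n \<le> \<delta>0" "\<tau>0 > 0" "\<delta>0 > 0" "\<delta>0 < m q"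
    using j_bound[OF qs] by blast
  obtain w where w: "w > 0" "\<And>n t. t \<in> {0..T} \<Longrightarrow> norm (f (qs n) t) \<le> w"
    using f_conv[OF qs] T by (meson compact_Icc)
  obtain p where p: "p > 0" "\<And>v. norm (\<pi> v) \<le> norm v * p"
    using bounded_linear.pos_bounded[OF \<pi>] by blast
  define P0 where "P0 = \<Lambda>b * (Bw + lb) + norm (A q 0 0) + L'' q * Bw + p * w + \<tau>0 + \<delta>0 * Bw"
  define Q0 where "Q0 = \<Lambda>b + L' q + \<delta>0"
  have Bw0: "Bw \<ge> 0" using Bw[of 0] norm_ge_zero order_trans by blast
  have \<Lambda>b0: "\<Lambda>b \<ge> 0" using \<Lambda>b[of 0] A(1)[of 0] by linarith
  have lb0: "lb \<ge> 0" using lb[of 0] A(2)[of 0] by linarith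
  have P0: "P0 \<ge> 0" and Q0: "Q0 \<ge> 0"
    using Bw0 \<Lambda>b0 lb0 p(1) w(1) \<tau>\<delta>(3,4) admissibleD(2,3)[OF q] by (simp_all add: P0_def Q0_def)
  have main: "(m q - \<delta>0) * norm (u (qs n) t - ws n) \<le> P0 + Q0 * norm (x (qs n) t)"
    if t: "t \<in> {0..T}" for n t
  proof -
    have qn: "qs n \<in> U" using qs by blast
    have tI: "t \<in> I" using t T by blast
    let ?a = "x (qs n) t" and ?u = "u (qs n) t"
    have "(m q - \<delta>0) * norm (?u - ws n)
        \<le> norm (A (qs n) ?a (ws n)) + p * norm (f (qs n) t) + \<tau>0 + \<delta>0 * (norm ?a + norm (ws n))"
    proof (rule vi_solution_bound[where \<pi> = \<pi> and j = "j (qs n) ?a ?u"])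
      show "inner (f (qs n) t) (\<pi> (ws n) - \<pi> ?u)
          \<le> blinfun_apply (A (qs n) ?a ?u) (ws n - ?u) + j (qs n) ?a ?u (ws n) - j (qs n) ?a ?u ?u"
        by (rule solutionD(6)[OF qn tI ws(1)])
      have "m q * (norm (?u - ws n))\<^sup>2 \<le> m (qs n) * (norm (?u - ws n))\<^sup>2"
        using constants[OF qs] by (intro mult_right_mono) auto
      thus "m q * (norm (?u - ws n))\<^sup>2 \<le> blinfun_apply (A (qs n) ?a ?u - A (qs n) ?a (ws n)) (?u - ws n)"
        using admissibleD(12)[OF qn, of ?u "ws n" ?a] by linarith
      have "(\<tau> n + \<delta> n * (norm ?a + norm ?u)) * norm (ws n - ?u)
          \<le> (\<tau>0 + \<delta>0 * (norm ?a + norm ?u)) * norm (ws n - ?u)"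
        using \<tau>\<delta>(1,2) by (intro mult_right_mono add_mono) auto
      thus "j (qs n) ?a ?u (ws n) - j (qs n) ?a ?u ?u \<le> (\<tau>0 + \<delta>0 * (norm ?a + norm ?u)) * norm (ws n - ?u)"
        using jb[of n ?a ?u "ws n" ?u] by linarith
      show "norm (\<pi> ?u - \<pi> (ws n)) \<le> p * norm (?u - ws n)"
        using p(2)[of "?u - ws n"] linear_diff[OF bounded_linear.linear[OF \<pi>]] by (simp add: mult.commute)
    qed (use \<tau>\<delta> p in auto)
    moreover have "norm (A (qs n) ?a (ws n))
        \<le> \<Lambda>b * (norm ?a + Bw + lb) + L' q * norm ?a + L'' q * Bw + norm (A q 0 0)"
    proof -
      have "norm (A (qs n) ?a (ws n)) \<le> norm (A (qs n) ?a (ws n) - A q ?a (ws n))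
          + norm (A q ?a (ws n) - A q 0 (ws n)) + norm (A q 0 (ws n) - A q 0 0) + norm (A q 0 0)"
        by norm
      moreover have "\<Lambda> n * (norm ?a + norm (ws n) + l n) \<le> \<Lambda>b * (norm ?a + Bw + lb)"
        using \<Lambda>b[of n] Bw[of n] lb[of n] A(1,2)[of n] \<Lambda>b0 by (intro mult_mono add_mono) auto
      moreover have "L'' q * norm (ws n) \<le> L'' q * Bw"
        using Bw[of n] admissibleD(3)[OF q] by (intro mult_left_mono) auto
      ultimately show ?thesis
        using A(3)[of n ?a "ws n"] admissibleD(10)[OF q, of ?a "ws n" 0]
          admissibleD(11)[OF q, of 0 "ws n" 0] by simp
    qed
    moreover have "p * norm (f (qs n) t) \<le> p * w"
      using w(2)[OF t] p(1) by (intro mult_left_mono) auto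
    moreover have "\<delta>0 * (norm ?a + norm (ws n)) \<le> \<delta>0 * (norm ?a + Bw)"
      using Bw[of n] \<tau>\<delta>(4) by (intro mult_left_mono) auto
    ultimately show ?thesis by (simp add: P0_def Q0_def algebra_simps)
  qed
  have md: "m q - \<delta>0 > 0" using \<tau>\<delta>(5) by simp
  show ?thesis
  proof (rule that)
    fix n t assume "t \<in> {0..T}"
    hence "norm (u (qs n) t - ws n) \<le> (P0 + Q0 * norm (x (qs n) t)) / (m q - \<delta>0)"
      using main md by (simp add: pos_le_divide_eq mult.commute)
    thus "norm (u (qs n) t) \<le> (Bw + P0 / (m q - \<delta>0)) + Q0 / (m q - \<delta>0) * norm (x (qs n) t)"
      using Bw[of n] norm_triangle_sub[of "u (qs n) t" "ws n"] by (simp add: add_divide_distrib)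
  qed (use Bw0 P0 Q0 md in auto)
qed

text \<open>Difference of the two integrated state equations. The bound holds for any continuous majorant \<open>k\<close>
  of the integrand, so that it can be used both with a crude estimate of the gap of \<open>u\<close> and with the
  sharp one. The error \<open>e\<close> is the perturbation of \<open>F\<close> along the limit solution.\<close>

lemma state_gap_integral_bound:
  assumes qs: "\<forall>n. qs n \<in> U" "qs \<rightharpoonup> q" and T: "{0..T} \<subseteq> I"
  obtains B e where "B \<ge> 0" "\<And>n. e n \<ge> 0" "e \<longlonglongrightarrow> 0"
    "\<And>n t k. t \<in> {0..T} \<Longrightarrow> continuous_on {0..T} k \<Longrightarrow>
      (\<And>s. s \<in> {0..T} \<Longrightarrow>
        e n + B * (norm (x (qs n) s - x q s) + norm (u (qs n) s - u q s)) \<le> k s) \<Longrightarrow>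
      norm (x (qs n) t - x q t) \<le> norm (x (qs n) 0 - x q 0) + integral {0..t} k"
proof -
  note q = weak_limit_in_U[OF qs]
  obtain \<Gamma> \<gamma> where G: "\<And>n. \<Gamma> n \<ge> 0" "\<And>n. \<gamma> n \<ge> 0"
      "\<And>n t a b. t \<in> I \<Longrightarrow> norm (F (qs n) t a b - F q t a b) \<le> \<Gamma> n * (norm a + norm b + \<gamma> n)"
      "\<Gamma> \<longlonglongrightarrow> 0" "bounded (range \<gamma>)"
    using F_conv[OF qs] by blast
  obtain \<gamma>b where \<gamma>b: "\<And>n. \<gamma> n \<le> \<gamma>b"
    using G(5) unfolding bounded_iff by (auto simp: abs_le_iff)
  obtain Bx where Bx: "Bx \<ge> 0" "\<And>t. t \<in> {0..T} \<Longrightarrow> norm (x q t) \<le> Bx"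
    using bounded_on_interval[OF solutionD(1)[OF q] T] by blast
  obtain Bu where Bu: "Bu \<ge> 0" "\<And>t. t \<in> {0..T} \<Longrightarrow> norm (u q t) \<le> Bu"
    using bounded_on_interval[OF solutionD(2)[OF q] T] by blast
  define e where "e = (\<lambda>n. \<Gamma> n * (Bx + Bu + \<gamma>b))"
  define B where "B = LJ q {0..T}"
  have \<gamma>b0: "\<gamma>b \<ge> 0" using \<gamma>b[of 0] G(2)[of 0] by linarith
  have deriv: "norm (F (qs n) t (x (qs n) t) (u (qs n) t) - F q t (x q t) (u q t))
      \<le> e n + B * (norm (x (qs n) t - x q t) + norm (u (qs n) t - u q t))" if t: "t \<in> {0..T}" for n t
  proof -
    have "norm (F (qs n) t (x (qs n) t) (u (qs n) t) - F (qs n) t (x q t) (u q t))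
        \<le> LJ (qs n) {0..T} * (norm (x (qs n) t - x q t) + norm (u (qs n) t - u q t))"
      using qs T t by (intro admissibleD(9)) auto
    also have "\<dots> \<le> B * (norm (x (qs n) t - x q t) + norm (u (qs n) t - u q t))"
      using constants[OF qs] T by (intro mult_right_mono) (auto simp: B_def)
    finally have 1: "norm (F (qs n) t (x (qs n) t) (u (qs n) t) - F (qs n) t (x q t) (u q t))
        \<le> B * (norm (x (qs n) t - x q t) + norm (u (qs n) t - u q t))" .
    have "norm (F (qs n) t (x q t) (u q t) - F q t (x q t) (u q t)) \<le> \<Gamma> n * (norm (x q t) + norm (u q t) + \<gamma> n)"
      using G(3) T t by blast
    also have "\<dots> \<le> e n"
      unfolding e_def using G(1) Bx(2)[OF t] Bu(2)[OF t] \<gamma>b by (intro mult_left_mono add_mono)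
    finally show ?thesis
      using 1 norm_triangle_ineq[of "F (qs n) t (x (qs n) t) (u (qs n) t) - F (qs n) t (x q t) (u q t)"
          "F (qs n) t (x q t) (u q t) - F q t (x q t) (u q t)"] by simp
  qed
  show ?thesis
  proof (rule that)
    show "B \<ge> 0"
      unfolding B_def using admissibleD(1)[OF q, of "{0..T}"] T by simp
    show "e n \<ge> 0" for n
      using G(1)[of n] Bx(1) Bu(1) \<gamma>b0 by (simp add: e_def)
    show "e \<longlonglongrightarrow> 0"
      unfolding e_def using tendsto_mult_right[OF G(4), of "Bx + Bu + \<gamma>b"] by (simp add: mult.commute)
  next
    fix n t k
    assume t: "t \<in> {0..T}" and k: "continuous_on {0..T} k"
      and le: "\<And>s. s \<in> {0..T} \<Longrightarrow>
        e n + B * (norm (x (qs n) s - x q s) + norm (u (qs n) s - u q s)) \<le> k s"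
    have vd: "(x p has_vector_derivative F p s (x p s) (u p s)) (at s within {0..T})"
      if "p \<in> U" "s \<in> {0..T}" for p s
      using solutionD(4)[OF that(1), of s] that(2) T has_vector_derivative_within_subset by blast
    show "norm (x (qs n) t - x q t) \<le> norm (x (qs n) 0 - x q 0) + integral {0..t} k"
    proof (rule norm_diff_le_integral_derivative[OF vd vd k _ t])
      show "norm (F (qs n) s (x (qs n) s) (u (qs n) s) - F q s (x q s) (u q s)) \<le> k s"
        if "s \<in> {0..T}" for s
        using deriv[OF that, of n] le[OF that] by linarith
    qed (use qs q in auto)
  qed
qed

text \<open>With the linear growth of \<open>u\<close> in \<open>x\<close>, Gronwall's inequality bounds the gaps uniformly in \<open>n\<close> and
  \<open>t\<close>. This provides weakly convergent subsequences at each time and an integrable majorant.\<close>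

lemma gaps_bounded:
  assumes qs: "\<forall>n. qs n \<in> U" "qs \<rightharpoonup> q" and T: "{0..T} \<subseteq> I"
  obtains M where "\<And>n t. t \<in> {0..T} \<Longrightarrow> norm (x (qs n) t - x q t) \<le> M"
    "\<And>n t. t \<in> {0..T} \<Longrightarrow> norm (u (qs n) t - u q t) \<le> M"
proof -
  note q = weak_limit_in_U[OF qs]
  have qn: "qs n \<in> U" for n using qs(1) by blast
  obtain P Q where PQ: "P \<ge> 0" "Q \<ge> 0"
      "\<And>n t. t \<in> {0..T} \<Longrightarrow> norm (u (qs n) t) \<le> P + Q * norm (x (qs n) t)"
    using u_growth[OF qs T] by blast
  obtain Bx where Bx: "Bx \<ge> 0" "\<And>t. t \<in> {0..T} \<Longrightarrow> norm (x q t) \<le> Bx"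
    using bounded_on_interval[OF solutionD(1)[OF q] T] by blast
  obtain Bu where Bu: "Bu \<ge> 0" "\<And>t. t \<in> {0..T} \<Longrightarrow> norm (u q t) \<le> Bu"
    using bounded_on_interval[OF solutionD(2)[OF q] T] by blast
  define C where "C = P + Q * Bx + Bu"
  have C: "C \<ge> 0" using PQ Bx(1) Bu(1) by (simp add: C_def)
  have u_le: "norm (u (qs n) t - u q t) \<le> C + Q * norm (x (qs n) t - x q t)"
    if t: "t \<in> {0..T}" for n t
  proof -
    have "norm (x (qs n) t) \<le> Bx + norm (x (qs n) t - x q t)"
      using norm_triangle_sub[of "x (qs n) t" "x q t"] Bx(2)[OF t] by simp
    hence "Q * norm (x (qs n) t) \<le> Q * (Bx + norm (x (qs n) t - x q t))"
      using PQ(2) by (intro mult_left_mono)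
    thus ?thesis
      using PQ(3)[OF t, of n] Bu(2)[OF t] norm_triangle_ineq4[of "u (qs n) t" "u q t"]
      by (simp add: C_def algebra_simps)
  qed
  obtain B e where B: "B \<ge> 0" and e: "\<And>n. e n \<ge> 0" "e \<longlonglongrightarrow> 0"
    and gap: "\<And>n t k. t \<in> {0..T} \<Longrightarrow> continuous_on {0..T} k \<Longrightarrow>
      (\<And>s. s \<in> {0..T} \<Longrightarrow>
        e n + B * (norm (x (qs n) s - x q s) + norm (u (qs n) s - u q s)) \<le> k s) \<Longrightarrow>
      norm (x (qs n) t - x q t) \<le> norm (x (qs n) 0 - x q 0) + integral {0..t} k"
    using state_gap_integral_bound[OF qs T] by blast
  obtain eb where eb: "\<And>n. e n \<le> eb"
    using convergent_imp_bounded[OF e(2)] unfolding bounded_iff by (auto simp: abs_le_iff)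
  have "(\<lambda>n. norm (x (qs n) 0 - x q 0)) \<longlonglongrightarrow> 0"
    using x0_conv[OF qs] solutionD(3)[OF qn] solutionD(3)[OF q] by (simp add: tendsto_norm_zero LIM_zero)
  from convergent_imp_bounded[OF this] obtain B0 where B0: "\<And>n. norm (x (qs n) 0 - x q 0) \<le> B0"
    unfolding bounded_iff by auto
  define h where "h = eb + B * C"
  define b where "b = B * (1 + Q)"
  have h: "h \<ge> 0" and b: "b \<ge> 0"
    using e(1)[of 0] eb[of 0] B C PQ(2) by (simp_all add: h_def b_def)
  have dc: "continuous_on {0..T} (\<lambda>s. norm (x (qs n) s - x q s))" for n
    by (intro continuous_intros continuous_on_subset[OF solutionD(1) T] qn q)
  define M where "M = (B0 + integral {0..T} (\<lambda>_. h)) * exp (b * T)"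
  have d_le: "norm (x (qs n) t - x q t) \<le> M" if t: "t \<in> {0..T}" for n t
  proof -
    have "norm (x (qs n) t - x q t) \<le> (B0 + integral {0..T} (\<lambda>_. h)) * exp (b * t)"
    proof (rule gronwall_forced[OF dc _ _ b _ t])
      fix r assume r: "r \<in> {0..T}"
      have "norm (x (qs n) r - x q r)
          \<le> norm (x (qs n) 0 - x q 0) + integral {0..r} (\<lambda>s. h + b * norm (x (qs n) s - x q s))"
      proof (rule gap[OF r])
        fix s assume s: "s \<in> {0..T}"
        have "B * norm (u (qs n) s - u q s) \<le> B * (C + Q * norm (x (qs n) s - x q s))"
          using u_le[OF s] B by (intro mult_left_mono)
        thus "e n + B * (norm (x (qs n) s - x q s) + norm (u (qs n) s - u q s))
            \<le> h + b * norm (x (qs n) s - x q s)"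
          using eb[of n] by (simp add: h_def b_def algebra_simps)
      qed (intro continuous_intros dc)
      thus "norm (x (qs n) r - x q r) \<le> B0 + integral {0..r} (\<lambda>s. h + b * norm (x (qs n) s - x q s))"
        using B0[of n] by linarith
    qed (use h in auto)
    also have "\<dots> \<le> M"
    proof -
      have "0 \<le> B0 + integral {0..T} (\<lambda>_. h)"
        using h t order_trans[OF norm_ge_zero B0[of 0]] by simp
      thus ?thesis unfolding M_def using b t by (intro mult_left_mono) (auto intro: mult_left_mono)
    qed
    finally show ?thesis .
  qed
  show ?thesis
  proof (rule that[of "max M (C + Q * M)"])
    fix n t assume t: "t \<in> {0..T}"
    show "norm (x (qs n) t - x q t) \<le> max M (C + Q * M)" using d_le[OF t] by (simp add: max.coboundedI1)
    have "Q * norm (x (qs n) t - x q t) \<le> Q * M"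
      using d_le[OF t] PQ(2) by (intro mult_left_mono)
    thus "norm (u (qs n) t - u q t) \<le> max M (C + Q * M)" using u_le[OF t, of n] by linarith
  qed
qed

lemma gap_limit_le:
  assumes qs: "\<forall>n. qs n \<in> U" "qs \<rightharpoonup> q" and t: "t \<in> I"
    and weak: "(\<lambda>n. u (qs n) t) \<rightharpoonup> b"
    and d: "(\<lambda>n. norm (x (qs n) t - x q t)) \<longlonglongrightarrow> d"
    and s: "(\<lambda>n. norm (u (qs n) t - u q t)) \<longlonglongrightarrow> s"
  shows "(m q - \<beta> q) * s \<le> (L' q + \<alpha> q) * d"
proof -
  note q = weak_limit_in_U[OF qs]
  have qn: "qs n \<in> U" for n using qs(1) by blast
  obtain w where w: "\<And>n. norm (f (qs n) t) \<le> w"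
    using conjunct2[OF f_conv[OF qs], rule_format, of "{t}"] t by auto
  obtain \<Lambda> l where A: "\<And>n. \<Lambda> n \<ge> 0" "\<And>n. l n \<ge> 0"
      "\<And>n a b. norm (A (qs n) a b - A q a b) \<le> \<Lambda> n * (norm a + norm b + l n)"
      "\<Lambda> \<longlonglongrightarrow> 0" "bounded (range l)"
    using A_conv[OF qs] by blast
  obtain lb where lb: "\<And>n. l n \<le> lb"
    using A(5) unfolding bounded_iff by (auto simp: abs_le_iff)
  obtain Bs where Bs: "\<And>n. norm (u (qs n) t - u q t) \<le> Bs"
    using convergent_imp_bounded[OF s] unfolding bounded_iff by auto
  have A_lim: "(\<lambda>n. norm (A (qs n) (x q t) (u (qs n) t) - A q (x q t) (u (qs n) t))) \<longlonglongrightarrow> 0"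
  proof (rule Lim_null_comparison)
    have "norm (A (qs n) (x q t) (u (qs n) t) - A q (x q t) (u (qs n) t))
        \<le> \<Lambda> n * (norm (x q t) + (norm (u q t) + Bs) + lb)" for n
    proof -
      have "norm (u (qs n) t) \<le> norm (u q t) + Bs"
        using norm_triangle_sub[of "u (qs n) t" "u q t"] Bs[of n] by simp
      hence "\<Lambda> n * (norm (x q t) + norm (u (qs n) t) + l n)
          \<le> \<Lambda> n * (norm (x q t) + (norm (u q t) + Bs) + lb)"
        using A(1) lb by (intro mult_left_mono add_mono) auto
      thus ?thesis using A(3)[of n "x q t" "u (qs n) t"] by linarith
    qed
    thus "\<forall>\<^sub>F n in sequentially. norm (norm (A (qs n) (x q t) (u (qs n) t) - A q (x q t) (u (qs n) t)))
        \<le> \<Lambda> n * (norm (x q t) + (norm (u q t) + Bs) + lb)" by simp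
    show "(\<lambda>n. \<Lambda> n * (norm (x q t) + (norm (u q t) + Bs) + lb)) \<longlonglongrightarrow> 0"
      using tendsto_mult_right[OF A(4), of "norm (x q t) + (norm (u q t) + Bs) + lb"]
      by (simp add: mult.commute)
  qed
  show ?thesis
  proof (rule vi_gap[where \<pi> = \<pi> and K = "K q" and Kn = "\<lambda>n. K (qs n)" and A = "A q" and An = "\<lambda>n. A (qs n)"
        and j = "j q" and jn = "\<lambda>n. j (qs n)" and f = "f q t" and fn = "\<lambda>n. f (qs n) t"
        and x = "x q t" and xn = "\<lambda>n. x (qs n) t" and u = "u q t" and un = "\<lambda>n. u (qs n) t"
        and L'' = "L'' q"])
    show "(\<lambda>n. f (qs n) t) \<rightharpoonup> f q t" using f_conv[OF qs] t by blast
    show "norm (A (qs n) x1 v - A (qs n) x2 v) \<le> L' q * norm (x1 - x2)" for n x1 x2 v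
    proof -
      have "L' (qs n) * norm (x1 - x2) \<le> L' q * norm (x1 - x2)"
        using constants[OF qs] by (intro mult_right_mono) auto
      thus ?thesis using admissibleD(10)[OF qn, of n x1 v x2] by linarith
    qed
    show "j (qs n) x1 v v2 - j (qs n) x1 v v1 + j (qs n) x2 v v1 - j (qs n) x2 v v2
        \<le> \<alpha> q * norm (x1 - x2) * norm (v1 - v2)" for n x1 x2 v v1 v2
    proof -
      have "\<alpha> (qs n) * norm (x1 - x2) * norm (v1 - v2) \<le> \<alpha> q * norm (x1 - x2) * norm (v1 - v2)"
        using constants[OF qs] by (intro mult_right_mono) auto
      thus ?thesis using admissibleD(13)[OF qn, of n x1 v v2 v1 x2 v] by simp
    qed
    show "j q (x q t) u1 v2 - j q (x q t) u1 v1 + j q (x q t) u2 v1 - j q (x q t) u2 v2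
        \<le> \<beta> q * norm (u1 - u2) * norm (v1 - v2)" for u1 u2 v1 v2
      using admissibleD(13)[OF q, of "x q t" u1 v2 v1 "x q t" u2] by simp
    show "limsup (\<lambda>n. ereal (j (qs n) (x q t) (u (qs n) t) (vs n) - j (qs n) (x q t) (u (qs n) t) (u (qs n) t)))
        \<le> ereal (j q (x q t) b v - j q (x q t) b b)"
      if "(\<lambda>n. u (qs n) t) \<rightharpoonup> b" "vs \<rightharpoonup> v" for vs b v
      using j_limsup[OF qs] that by blast
    show "L' q \<ge> 0" "L'' q \<ge> 0" "\<alpha> q \<ge> 0" "\<beta> q \<ge> 0"
      using admissibleD(2,3,5,6)[OF q] by simp_all
  qed (fact \<pi>_compl solutionD(5,6)[OF qn t] solutionD(5,6)[OF q t] admissibleD(11,12)[OF q] A_lim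
      K_conv[OF qs] w weak d s)+
qed

definition gap_ratio :: "'w \<Rightarrow> real" where
  "gap_ratio q = (L' q + \<alpha> q) / (m q - \<beta> q)"

text \<open>The amount by which the gap of \<open>u\<close> exceeds its asymptotic bound by the gap of \<open>x\<close>. It is
  continuous in time, which makes it integrable, although the limits in \<open>vi_gap\<close> are only taken at fixed
  times.\<close>

definition excess :: "'w \<Rightarrow> 'w \<Rightarrow> real \<Rightarrow> real" where
  "excess q p t = max 0 (norm (u p t - u q t) - gap_ratio q * norm (x p t - x q t))"

lemma gap_ratio_nonneg: "q \<in> U \<Longrightarrow> gap_ratio q \<ge> 0"
  using admissibleD(2,5,7)[of q] by (simp add: gap_ratio_def)

text \<open>From any subsequence one can extract a further one along which \<open>u\<close> converges weakly and both
  gaps converge, as \<open>gap_limit_le\<close> requires.\<close>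

lemma excess_LIMSEQ:
  assumes qs: "\<forall>n. qs n \<in> U" "qs \<rightharpoonup> q" and t: "t \<in> I"
  shows "(\<lambda>n. excess q (qs n) t) \<longlonglongrightarrow> 0"
proof (rule LIMSEQ_if_subsequences)
  fix s1 :: "nat \<Rightarrow> nat" assume s1: "strict_mono s1"
  note q = weak_limit_in_U[OF qs]
  obtain M where "\<And>n s. s \<in> {0..t} \<Longrightarrow> norm (x (qs n) s - x q s) \<le> M"
      "\<And>n s. s \<in> {0..t} \<Longrightarrow> norm (u (qs n) s - u q s) \<le> M"
    using gaps_bounded[OF qs interval_subset[OF t]] by blast
  hence M: "\<And>n. norm (x (qs n) t - x q t) \<le> M" "\<And>n. norm (u (qs n) t - u q t) \<le> M"
    using nonneg_I[OF t] by simp_all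
  have "norm (u (qs n) t) \<le> norm (u q t) + M" for n
    using norm_triangle_sub[of "u (qs n) t" "u q t"] M(2)[of n] by simp
  hence "bounded (range (\<lambda>n. u (qs (s1 n)) t))"
    unfolding bounded_iff by blast
  then obtain s2 :: "nat \<Rightarrow> nat" and b where s2: "strict_mono s2" and b: "(\<lambda>n. u (qs (s1 (s2 n))) t) \<rightharpoonup> b"
    by (rule reflexive_bounded_weak_subsequence[OF V_reflexive])
  have "bounded (range (\<lambda>n. norm (x (qs (s1 (s2 n))) t - x q t)))"
    unfolding bounded_iff using M(1) by auto
  from bounded_imp_convergent_subsequence[OF this] obtain d and s3 :: "nat \<Rightarrow> nat"
    where s3: "strict_mono s3" and d: "(\<lambda>n. norm (x (qs (s1 (s2 (s3 n)))) t - x q t)) \<longlonglongrightarrow> d"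
    by (auto simp: o_def)
  have "bounded (range (\<lambda>n. norm (u (qs (s1 (s2 (s3 n)))) t - u q t)))"
    unfolding bounded_iff using M(2) by auto
  from bounded_imp_convergent_subsequence[OF this] obtain s and s4 :: "nat \<Rightarrow> nat"
    where s4: "strict_mono s4" and s: "(\<lambda>n. norm (u (qs (s1 (s2 (s3 (s4 n))))) t - u q t)) \<longlonglongrightarrow> s"
    by (auto simp: o_def)
  define r where "r = s2 \<circ> s3 \<circ> s4"
  have r: "strict_mono r"
    unfolding r_def using s2 s3 s4 by (intro strict_mono_o)
  have d': "(\<lambda>n. norm (x (qs (s1 (r n))) t - x q t)) \<longlonglongrightarrow> d"
    using LIMSEQ_subseq_LIMSEQ[OF d s4] by (simp add: r_def o_def)
  have s': "(\<lambda>n. norm (u (qs (s1 (r n))) t - u q t)) \<longlonglongrightarrow> s"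
    using s by (simp add: r_def o_def)
  have "(m q - \<beta> q) * s \<le> (L' q + \<alpha> q) * d"
  proof (rule gap_limit_le[of "\<lambda>n. qs (s1 (r n))", OF _ _ t _ d' s'])
    show "(\<lambda>n. qs (s1 (r n))) \<rightharpoonup> q"
      by (rule weak_LIMSEQ_subseq[OF weak_LIMSEQ_subseq[OF qs(2) s1] r])
    show "(\<lambda>n. u (qs (s1 (r n))) t) \<rightharpoonup> b"
      using weak_LIMSEQ_subseq[OF weak_LIMSEQ_subseq[OF b s3] s4] by (simp add: r_def)
  qed (use qs in auto)
  hence "max 0 (s - gap_ratio q * d) = 0"
    using admissibleD(7)[OF q] by (simp add: gap_ratio_def pos_le_divide_eq mult.commute)
  moreover have "(\<lambda>n. excess q (qs (s1 (r n))) t) \<longlonglongrightarrow> max 0 (s - gap_ratio q * d)"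
    unfolding excess_def by (intro tendsto_intros d' s')
  ultimately have "(\<lambda>n. excess q (qs (s1 (r n))) t) \<longlonglongrightarrow> 0" by simp
  thus "\<exists>r. strict_mono r \<and> ((\<lambda>n. excess q (qs n) t) \<circ> s1 \<circ> r) \<longlonglongrightarrow> 0"
    using r by (auto simp: o_def)
qed

text \<open>Inserting the bound of the gap of \<open>u\<close> by the gap of \<open>x\<close> and the excess into the integrated state
  equation, Gronwall's inequality bounds the gap of \<open>x\<close> by the initial gap and the integral of the
  excess, which vanishes in the limit by dominated convergence.\<close>

theorem solutions_LIMSEQ:
  assumes qs: "\<forall>n. qs n \<in> U" "qs \<rightharpoonup> q" and t: "t \<in> I"
  shows "(\<lambda>n. x (qs n) t) \<longlonglongrightarrow> x q t" "(\<lambda>n. u (qs n) t) \<longlonglongrightarrow> u q t"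
proof -
  note q = weak_limit_in_U[OF qs]
  have qn: "qs n \<in> U" for n using qs(1) by blast
  note T = interval_subset[OF t]
  have tt: "t \<in> {0..t}" using nonneg_I[OF t] by simp
  obtain M where "\<And>n s. s \<in> {0..t} \<Longrightarrow> norm (x (qs n) s - x q s) \<le> M"
      and M: "\<And>n s. s \<in> {0..t} \<Longrightarrow> norm (u (qs n) s - u q s) \<le> M"
    using gaps_bounded[OF qs T] by blast
  obtain B e where B: "B \<ge> 0" and e: "\<And>n. e n \<ge> 0" "e \<longlonglongrightarrow> 0"
    and gap: "\<And>n r k. r \<in> {0..t} \<Longrightarrow> continuous_on {0..t} k \<Longrightarrow>
      (\<And>s. s \<in> {0..t} \<Longrightarrow>
        e n + B * (norm (x (qs n) s - x q s) + norm (u (qs n) s - u q s)) \<le> k s) \<Longrightarrow>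
      norm (x (qs n) r - x q r) \<le> norm (x (qs n) 0 - x q 0) + integral {0..r} k"
    using state_gap_integral_bound[OF qs T] by blast
  define b where "b = B * (1 + gap_ratio q)"
  have b: "b \<ge> 0" using B gap_ratio_nonneg[OF q] by (simp add: b_def)
  have dc: "continuous_on {0..t} (\<lambda>s. norm (x (qs n) s - x q s))" for n
    by (intro continuous_intros continuous_on_subset[OF solutionD(1) T] qn q)
  have uc: "continuous_on {0..t} (\<lambda>s. norm (u (qs n) s - u q s))" for n
    by (intro continuous_intros continuous_on_subset[OF solutionD(2) T] qn q)
  have exc: "continuous_on {0..t} (\<lambda>s. excess q (qs n) s)" for n
    unfolding excess_def
    by (intro continuous_on_max continuous_on_diff continuous_on_mult continuous_on_const uc dc)
  define h where "h = (\<lambda>n s. e n + B * excess q (qs n) s)"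
  have hc: "continuous_on {0..t} (h n)" for n
    unfolding h_def by (intro continuous_intros exc)
  have u_le: "norm (u (qs n) s - u q s) \<le> gap_ratio q * norm (x (qs n) s - x q s) + excess q (qs n) s" for n s
    by (simp add: excess_def)
  have bound: "norm (x (qs n) t - x q t)
      \<le> (norm (x (qs n) 0 - x q 0) + integral {0..t} (h n)) * exp (b * t)" for n
  proof (rule gronwall_forced[OF dc hc _ b _ tt])
    show "h n s \<ge> 0" for s
      using e(1) B by (simp add: h_def excess_def)
  next
    fix r assume r: "r \<in> {0..t}"
    show "norm (x (qs n) r - x q r)
        \<le> norm (x (qs n) 0 - x q 0) + integral {0..r} (\<lambda>s. h n s + b * norm (x (qs n) s - x q s))"
    proof (rule gap[OF r])
      fix s assume s: "s \<in> {0..t}"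
      have "B * norm (u (qs n) s - u q s)
          \<le> B * (gap_ratio q * norm (x (qs n) s - x q s) + excess q (qs n) s)"
        using u_le B by (intro mult_left_mono)
      thus "e n + B * (norm (x (qs n) s - x q s) + norm (u (qs n) s - u q s))
          \<le> h n s + b * norm (x (qs n) s - x q s)"
        by (simp add: h_def b_def algebra_simps)
    qed (intro continuous_intros dc hc)
  qed
  obtain eb where eb: "\<And>n. e n \<le> eb"
    using convergent_imp_bounded[OF e(2)] unfolding bounded_iff by (auto simp: abs_le_iff)
  have "(\<lambda>n. integral {0..t} (h n)) \<longlonglongrightarrow> integral {0..t} (\<lambda>_. 0)"
  proof (rule dominated_convergence(2))
    show "h n integrable_on {0..t}" for n
      by (rule integrable_continuous_real[OF hc])
    show "(\<lambda>_. eb + B * M) integrable_on {0..t}"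
      by (rule integrable_const_ivl)
  next
    fix n s assume s: "s \<in> {0..t}"
    have "excess q (qs n) s \<le> M"
      using M[OF s, of n] order_trans[OF norm_ge_zero M[OF s, of n]]
        mult_nonneg_nonneg[OF gap_ratio_nonneg[OF q], of "norm (x (qs n) s - x q s)"]
      unfolding excess_def by simp
    hence "B * excess q (qs n) s \<le> B * M" using B by (intro mult_left_mono)
    thus "norm (h n s) \<le> eb + B * M"
      using eb[of n] e(1)[of n] B by (simp add: h_def excess_def)
  next
    fix s assume s: "s \<in> {0..t}"
    hence "(\<lambda>n. excess q (qs n) s) \<longlonglongrightarrow> 0"
      using T by (intro excess_LIMSEQ[OF qs]) auto
    from tendsto_add[OF e(2) tendsto_mult[OF tendsto_const[of B] this]]
    show "(\<lambda>n. h n s) \<longlonglongrightarrow> 0"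
      by (simp add: h_def)
  qed
  hence int_lim: "(\<lambda>n. integral {0..t} (h n)) \<longlonglongrightarrow> 0" by simp
  have "(\<lambda>n. norm (x (qs n) 0 - x q 0)) \<longlonglongrightarrow> 0"
    using x0_conv[OF qs] solutionD(3)[OF qn] solutionD(3)[OF q] by (simp add: tendsto_norm_zero LIM_zero)
  from tendsto_mult[OF tendsto_add[OF this int_lim] tendsto_const[of "exp (b * t)"]]
  have lim: "(\<lambda>n. (norm (x (qs n) 0 - x q 0) + integral {0..t} (h n)) * exp (b * t)) \<longlonglongrightarrow> 0"
    by simp
  have d: "(\<lambda>n. norm (x (qs n) t - x q t)) \<longlonglongrightarrow> 0"
    by (rule Lim_null_comparison[OF _ lim]) (simp add: bound)
  have "(\<lambda>n. gap_ratio q * norm (x (qs n) t - x q t) + excess q (qs n) t) \<longlonglongrightarrow> 0"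
    using tendsto_add[OF tendsto_mult[OF tendsto_const[of "gap_ratio q"] d] excess_LIMSEQ[OF qs t]] by simp
  hence s: "(\<lambda>n. norm (u (qs n) t - u q t)) \<longlonglongrightarrow> 0"
    by (rule Lim_null_comparison[rotated]) (simp add: u_le)
  show "(\<lambda>n. x (qs n) t) \<longlonglongrightarrow> x q t"
    using d by (simp add: tendsto_norm_zero_iff LIM_zero_iff)
  show "(\<lambda>n. u (qs n) t) \<longlonglongrightarrow> u q t"
    using s by (simp add: tendsto_norm_zero_iff LIM_zero_iff)
qed

end

section \<open>Existence of minimizers\<close>

text \<open>The direct method. The infimum \<open>\<mu>\<close> is taken in the extended reals, since boundedness from below
  is only known a posteriori.\<close>

lemma weakly_coercive_attains_min:
  fixes U :: "'w::real_normed_vector set" and \<phi> :: "'w \<Rightarrow> real"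
  assumes refl: "reflexive_space TYPE('w)"
    and U: "U \<noteq> {}" "closedin weak_topology U"
    and lsc: "\<And>qs q. \<forall>n. qs n \<in> U \<Longrightarrow> qs \<rightharpoonup> q \<Longrightarrow> ereal (\<phi> q) \<le> liminf (\<lambda>n. ereal (\<phi> (qs n)))"
    and coercive: "\<And>qs :: nat \<Rightarrow> 'w. \<forall>n. qs n \<in> U \<Longrightarrow> filterlim (\<lambda>n. norm (qs n)) at_top sequentially \<Longrightarrow>
      filterlim (\<lambda>n. \<phi> (qs n)) at_top sequentially"
  shows "\<exists>q\<in>U. \<forall>p\<in>U. \<phi> q \<le> \<phi> p"
proof (rule ccontr)
  assume no_min: "\<not> ?thesis"
  obtain q0 where q0: "q0 \<in> U" using U(1) by blast
  then obtain q1 where q1: "q1 \<in> U" "\<phi> q1 < \<phi> q0" using no_min by (meson not_le)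
  define \<mu> where "\<mu> = Inf ((\<lambda>p. ereal (\<phi> p)) ` U)"
  have \<mu>: "\<mu> \<le> ereal (\<phi> p)" if "p \<in> U" for p
    unfolding \<mu>_def using that by (rule INF_lower)
  obtain y where y: "\<And>n. y n \<in> (\<lambda>p. ereal (\<phi> p)) ` U" "y \<longlonglongrightarrow> \<mu>"
    using Inf_as_limit[of "(\<lambda>p. ereal (\<phi> p)) ` U"] U(1) unfolding \<mu>_def by auto
  have "\<forall>n. \<exists>p. p \<in> U \<and> y n = ereal (\<phi> p)" using y(1) by blast
  from choice[OF this] obtain ps where ps: "\<And>n. ps n \<in> U" "\<And>n. y n = ereal (\<phi> (ps n))" by blast
  have "\<mu> < ereal (\<phi> q0)" using \<mu>[OF q1(1)] q1(2) by (simp add: order_le_less_trans)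
  hence "\<forall>\<^sub>F n in sequentially. y n < ereal (\<phi> q0)"
    by (rule order_tendstoD(2)[OF y(2)])
  then obtain N where N: "\<And>n. n \<ge> N \<Longrightarrow> \<phi> (ps n) < \<phi> q0"
    unfolding eventually_sequentially by (auto simp: ps(2))
  \<comment> \<open>Dropping an initial segment keeps the values below \<open>\<phi> q0\<close>, so that coercivity bounds the
    sequence.\<close>
  define qs where "qs = (\<lambda>n. ps (n + N))"
  have qs: "\<And>n. qs n \<in> U" "\<And>n. \<phi> (qs n) < \<phi> q0"
    using ps(1) N by (auto simp: qs_def)
  have lim: "(\<lambda>n. ereal (\<phi> (qs n))) \<longlonglongrightarrow> \<mu>"
    using LIMSEQ_ignore_initial_segment[OF y(2), of N] by (simp add: qs_def ps(2))
  have "bounded (range qs)"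
  proof (rule ccontr)
    assume "\<not> bounded (range qs)"
    hence "\<exists>n. real k < norm (qs n)" for k
      unfolding bounded_iff by (auto simp: not_le)
    hence "\<forall>k. \<exists>n. real k < norm (qs n)" by blast
    from choice[OF this] obtain a where a: "\<forall>k. real k < norm (qs (a k))" ..
    have "filterlim (\<lambda>k. norm (qs (a k))) at_top sequentially"
      by (rule filterlim_at_top_mono[OF filterlim_real_sequentially]) (simp add: a less_imp_le)
    hence "filterlim (\<lambda>k. \<phi> (qs (a k))) at_top sequentially"
      using qs(1) by (intro coercive) auto
    hence "\<forall>\<^sub>F k in sequentially. \<phi> q0 \<le> \<phi> (qs (a k))"
      unfolding filterlim_at_top by blast
    then obtain k where "\<phi> q0 \<le> \<phi> (qs (a k))"
      unfolding eventually_sequentially by blast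
    thus False using qs(2)[of "a k"] by simp
  qed
  then obtain r q where r: "strict_mono r" and q: "(\<lambda>n. qs (r n)) \<rightharpoonup> q"
    by (rule reflexive_bounded_weak_subsequence[OF refl])
  have "q \<in> U" using weakly_closed_weak_limit[OF U(2) _ q] qs(1) by blast
  have "(\<lambda>n. ereal (\<phi> (qs (r n)))) \<longlonglongrightarrow> \<mu>"
    using LIMSEQ_subseq_LIMSEQ[OF lim r] by (simp add: o_def)
  hence "liminf (\<lambda>n. ereal (\<phi> (qs (r n)))) = \<mu>"
    by (intro lim_imp_Liminf) auto
  moreover have "ereal (\<phi> q) \<le> liminf (\<lambda>n. ereal (\<phi> (qs (r n))))"
    using qs(1) q by (intro lsc) auto
  ultimately have "\<phi> q \<le> \<phi> p" if "p \<in> U" for p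
    using \<mu>[OF that] order_trans[of "ereal (\<phi> q)" \<mu> "ereal (\<phi> p)"] by simp
  thus False using no_min \<open>q \<in> U\<close> by blast
qed

theorem theorem4p1:
  fixes I :: "real set"
    and \<pi> :: "'v::banach \<Rightarrow> 'z::{real_inner, complete_space}"
    and U :: "'w::banach set"
    and F :: "'w \<Rightarrow> real \<Rightarrow> 'x::banach \<Rightarrow> 'v \<Rightarrow> 'x"
    and x0 :: "'w \<Rightarrow> 'x"
    and K :: "'w \<Rightarrow> 'v set"
    and A :: "'w \<Rightarrow> 'x \<Rightarrow> 'v \<Rightarrow> 'v \<Rightarrow>\<^sub>L real"
    and j :: "'w \<Rightarrow> 'x \<Rightarrow> 'v \<Rightarrow> 'v \<Rightarrow> real"
    and f :: "'w \<Rightarrow> real \<Rightarrow> 'z"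
    and LJ :: "'w \<Rightarrow> real set \<Rightarrow> real"
    and L' L'' m \<alpha> \<beta> :: "'w \<Rightarrow> real"
    and x :: "'w \<Rightarrow> real \<Rightarrow> 'x"
    and u :: "'w \<Rightarrow> real \<Rightarrow> 'v"
    and \<L> :: "'x \<Rightarrow> 'v \<Rightarrow> 'w \<Rightarrow> real"
  assumes I: "(\<exists>T>0. I = {0..T}) \<or> I = {0..}"
    and V_reflexive: "reflexive_space TYPE('v)"
    and W_reflexive: "reflexive_space TYPE('w)"
    and U: "U \<noteq> {}" "closedin weak_topology U"
    and \<pi>: "bounded_linear \<pi>"
    and \<pi>_compl: "\<And>vs v. vs \<rightharpoonup> v \<Longrightarrow> (\<lambda>n. \<pi> (vs n)) \<longlonglongrightarrow> \<pi> v"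
    and admissible: "\<And>q. q \<in> U \<Longrightarrow>
          admissible I (F q) (K q) (A q) (j q) (f q) (LJ q) (L' q) (L'' q) (m q) (\<alpha> q) (\<beta> q)"
    and solution: "\<And>q. q \<in> U \<Longrightarrow>
          solves_P I \<pi> (F q) (x0 q) (K q) (A q) (j q) (f q) (x q) (u q)"
    and \<L>_lsc: "\<And>xs a us b qs q.
          xs \<longlonglongrightarrow> a \<Longrightarrow> us \<longlonglongrightarrow> b \<Longrightarrow> (\<forall>n. qs n \<in> U) \<Longrightarrow> qs \<rightharpoonup> q \<Longrightarrow>
          liminf (\<lambda>n. ereal (\<L> (xs n) (us n) (qs n))) \<ge> ereal (\<L> a b q)"
    and coercive_or_bounded:
      "(\<exists>z :: 'w \<Rightarrow> real. (\<forall>a b. \<forall>q\<in>U. \<L> a b q \<ge> z q) \<and>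
          (\<forall>qs :: nat \<Rightarrow> 'w. (\<forall>n. qs n \<in> U) \<longrightarrow>
             filterlim (\<lambda>n. norm (qs n)) at_top sequentially \<longrightarrow>
             filterlim (\<lambda>n. z (qs n)) at_top sequentially))
       \<or> bounded U"
    and constants: "\<And>qs q. (\<forall>n. qs n \<in> U) \<Longrightarrow> qs \<rightharpoonup> q \<Longrightarrow>
      (\<forall>n. (\<forall>J. compact J \<and> J \<subseteq> I \<longrightarrow> LJ (qs n) J \<le> LJ q J) \<and>
           L' (qs n) \<le> L' q \<and> L'' (qs n) \<le> L'' q \<and> m (qs n) \<ge> m q \<and>
           \<alpha> (qs n) \<le> \<alpha> q \<and> \<beta> (qs n) \<le> \<beta> q)"
    and F_conv: "\<And>qs q. (\<forall>n. qs n \<in> U) \<Longrightarrow> qs \<rightharpoonup> q \<Longrightarrow>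
      (\<exists>\<Gamma> \<gamma> :: nat \<Rightarrow> real.
           (\<forall>n. \<Gamma> n \<ge> 0 \<and> \<gamma> n \<ge> 0 \<and>
              (\<forall>t\<in>I. \<forall>a b. norm (F (qs n) t a b - F q t a b) \<le> \<Gamma> n * (norm a + norm b + \<gamma> n))) \<and>
           \<Gamma> \<longlonglongrightarrow> 0 \<and> bounded (range \<gamma>))"
    and x0_conv: "\<And>qs q. (\<forall>n. qs n \<in> U) \<Longrightarrow> qs \<rightharpoonup> q \<Longrightarrow>
      (\<lambda>n. x0 (qs n)) \<longlonglongrightarrow> x0 q"
    and K_conv: "\<And>qs q. (\<forall>n. qs n \<in> U) \<Longrightarrow> qs \<rightharpoonup> q \<Longrightarrow>
      mosco_converges (\<lambda>n. K (qs n)) (K q)"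
    and A_conv: "\<And>qs q. (\<forall>n. qs n \<in> U) \<Longrightarrow> qs \<rightharpoonup> q \<Longrightarrow>
      (\<exists>\<Lambda> l :: nat \<Rightarrow> real.
           (\<forall>n. \<Lambda> n \<ge> 0 \<and> l n \<ge> 0 \<and>
              (\<forall>a b. norm (A (qs n) a b - A q a b) \<le> \<Lambda> n * (norm a + norm b + l n))) \<and>
           \<Lambda> \<longlonglongrightarrow> 0 \<and> bounded (range l))"
    and j_bound: "\<And>qs q. (\<forall>n. qs n \<in> U) \<Longrightarrow> qs \<rightharpoonup> q \<Longrightarrow>
      (\<exists>\<tau> \<delta> :: nat \<Rightarrow> real.
           (\<forall>n. \<tau> n \<ge> 0 \<and> \<delta> n \<ge> 0 \<and>
              (\<forall>a b v1 v2. j (qs n) a b v1 - j (qs n) a b v2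
                 \<le> (\<tau> n + \<delta> n * (norm a + norm b)) * norm (v1 - v2))) \<and>
           (\<exists>\<tau>0>0. \<exists>\<delta>0>0. \<forall>n. \<tau> n \<le> \<tau>0 \<and> \<delta> n \<le> \<delta>0 \<and> \<delta>0 < m q))"
    and j_limsup: "\<And>qs q. (\<forall>n. qs n \<in> U) \<Longrightarrow> qs \<rightharpoonup> q \<Longrightarrow>
      (\<forall>us vs b v. us \<rightharpoonup> b \<longrightarrow> vs \<rightharpoonup> v \<longrightarrow>
           (\<forall>a. limsup (\<lambda>n. ereal (j (qs n) a (us n) (vs n) - j (qs n) a (us n) (us n)))
                  \<le> ereal (j q a b v - j q a b b)))"
    and f_conv: "\<And>qs q. (\<forall>n. qs n \<in> U) \<Longrightarrow> qs \<rightharpoonup> q \<Longrightarrow>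
      (\<forall>t\<in>I. (\<lambda>n. f (qs n) t) \<rightharpoonup> f q t) \<and>
      (\<forall>J. compact J \<and> J \<subseteq> I \<longrightarrow> (\<exists>w>0. \<forall>n. \<forall>t\<in>J. norm (f (qs n) t) \<le> w))"
  shows "\<forall>t\<in>I. \<exists>q\<in>U. \<forall>p\<in>U. \<L> (x q t) (u q t) q \<le> \<L> (x p t) (u p t) p"
proof
  interpret controlled_family I \<pi> U F x0 K A j f LJ L' L'' m \<alpha> \<beta> x u
    by (rule controlled_family.intro)
      (fact I V_reflexive U(2) \<pi> \<pi>_compl admissible solution constants F_conv x0_conv K_conv A_conv
        j_bound j_limsup f_conv)+
  fix t assume t: "t \<in> I"
  show "\<exists>q\<in>U. \<forall>p\<in>U. \<L> (x q t) (u q t) q \<le> \<L> (x p t) (u p t) p"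
  proof (rule weakly_coercive_attains_min[OF W_reflexive U])
    fix qs :: "nat \<Rightarrow> 'w" and q
    assume qs: "\<forall>n. qs n \<in> U" "qs \<rightharpoonup> q"
    show "ereal (\<L> (x q t) (u q t) q) \<le> liminf (\<lambda>n. ereal (\<L> (x (qs n) t) (u (qs n) t) (qs n)))"
      by (rule \<L>_lsc[OF solutions_LIMSEQ[OF qs t] qs])
  next
    fix qs :: "nat \<Rightarrow> 'w"
    assume qs: "\<forall>n. qs n \<in> U" and inf: "filterlim (\<lambda>n. norm (qs n)) at_top sequentially"
    show "filterlim (\<lambda>n. \<L> (x (qs n) t) (u (qs n) t) (qs n)) at_top sequentially"
      using coercive_or_bounded
    proof
      assume "\<exists>z :: 'w \<Rightarrow> real. (\<forall>a b. \<forall>q\<in>U. \<L> a b q \<ge> z q) \<and>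
          (\<forall>qs :: nat \<Rightarrow> 'w. (\<forall>n. qs n \<in> U) \<longrightarrow>
             filterlim (\<lambda>n. norm (qs n)) at_top sequentially \<longrightarrow>
             filterlim (\<lambda>n. z (qs n)) at_top sequentially)"
      then obtain z where z: "\<forall>a b. \<forall>q\<in>U. z q \<le> \<L> a b q"
        and z_inf: "\<forall>qs :: nat \<Rightarrow> 'w. (\<forall>n. qs n \<in> U) \<longrightarrow>
             filterlim (\<lambda>n. norm (qs n)) at_top sequentially \<longrightarrow>
             filterlim (\<lambda>n. z (qs n)) at_top sequentially"
        by (elim exE conjE)
      have "filterlim (\<lambda>n. z (qs n)) at_top sequentially"
        using z_inf[rule_format, of qs] qs inf by simp
      thus ?thesis
        by (rule filterlim_at_top_mono) (use z qs in simp)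
    next
      assume "bounded U"
      then obtain B where B: "\<And>q. q \<in> U \<Longrightarrow> norm q \<le> B" unfolding bounded_iff by blast
      have "\<forall>\<^sub>F n in sequentially. B + 1 \<le> norm (qs n)"
        using inf unfolding filterlim_at_top by blast
      then obtain n where "B + 1 \<le> norm (qs n)" unfolding eventually_sequentially by blast
      thus ?thesis using B[of "qs n"] qs by simp
    qed
  qed
qed

end
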